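(* Let $p,q\ge 0$ be integers with $p+1\le q$, let $a_1,\dots,a_p>0$ and $b_1,\dots,b_q>0$, and suppose that $s\mapsto {}_pF_q(a_1,\dots,a_p;b_1,\dots,b_q;-s^2)$, $s\in\mathbb{R}$, is the characteristic function of a real random variable with an even (symmetric) probability density. Then for every $x>0$, $$2\int_x^\infty\frac{{}_pF_q(a_1,\dots,a_p;b_1,\dots,b_q;-\xi^2)}{\xi}\,d\xi=-\gamma-2\ln x-\sum_{i=1}^p\psi(a_i)+\sum_{j=1}^q\psi(b_j)+T(x),$$ where $$T(x)=2\int_0^x\frac{1-{}_pF_q(a_1,\dots,a_p;b_1,\dots,b_q;-\xi^2)}{\xi}\,d\xi=-\sum_{k=1}^\infty\frac{(a_1)_k\cdots(a_p)_k}{(b_1)_k\cdots(b_q)_k}\,\frac{(-x^2)^k}{k\,k!}.$$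
   Context: The generalized hypergeometric function is ${}_pF_q(a_1,\dots,a_p;b_1,\dots,b_q;z)=\sum_{n=0}^\infty \frac{(a_1)_n\cdots(a_p)_n}{(b_1)_n\cdots(b_q)_n}\frac{z^n}{n!}$, where $(a)_n=\Gamma(a+n)/\Gamma(a)$ is the Pochhammer symbol; an empty list of parameters contributes an empty product (equal to $1$) and an empty sum (equal to $0$). $\psi=\Gamma'/\Gamma$ is the digamma function and $\gamma$ is Euler's constant. Integrals over $[x,\infty)$ are improper integrals $\lim_{R\to\infty}\int_x^R$. *)

theory Defs
  imports "HOL-Probability.Probability"
begin

text \<open>
  The generalized hypergeometric series with upper parameters \<open>as\<close> and lower parameters \<open>bs\<close>
  (so \<open>p = length as\<close> and \<open>q = length bs\<close>), as a function of its argument. For positive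
  parameters the library's rising factorial \<^const>\<open>pochhammer\<close> agrees with
  \<open>\<Gamma>(a + n) / \<Gamma>(a)\<close>, see \<open>pochhammer_Gamma\<close>.
\<close>
definition hypergeometric ::
  "'a::{real_normed_field,banach} list \<Rightarrow> 'a list \<Rightarrow> 'a \<Rightarrow> 'a" where
  "hypergeometric as bs z =
     (\<Sum>n. (\<Prod>a\<leftarrow>as. pochhammer a n) / (\<Prod>b\<leftarrow>bs. pochhammer b n) * (z ^ n / fact n))"

lemma hypergeometric_eq_eval_fps:
  "hypergeometric as bs z = eval_fps (fps_hypergeo as bs 1) z"
proof -
  have foldl_eq: "foldl (\<lambda>r a. r * pochhammer a n) c xs = c * (\<Prod>a\<leftarrow>xs. pochhammer a n)"
    for n and c :: 'a and xs
    by (induction xs arbitrary: c) (simp_all add: mult.assoc)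
  show ?thesis
    by (simp add: hypergeometric_def eval_fps_def foldl_eq)
qed

text \<open>
  The improper integral over \<open>[x, \<infinity>)\<close> as a limit of proper integrals. Local integrability is
  demanded explicitly because \<^const>\<open>integral\<close> is \<open>0\<close> on non-integrable functions.
\<close>
definition has_improper_integral_at_top ::
  "(real \<Rightarrow> real) \<Rightarrow> real \<Rightarrow> real \<Rightarrow> bool" where
  "has_improper_integral_at_top f I x \<longleftrightarrow>
     (\<forall>R\<ge>x. f integrable_on {x..R}) \<and> ((\<lambda>R. integral {x..R} f) \<longlongrightarrow> I) at_top"

end

theory Submission
  imports Defs "HOL-Real_Asymp.Real_Asymp"
begin

text \<open>
  Write \<open>F s = E[cos (s X)]\<close> for the hypergeometric characteristic function. Its Taylor coefficients
  show that \<open>Y = X\<^sup>2 / 4\<close> has the moments \<open>E[Y\<^sup>n] = (1/2)\<^sub>n (a)\<^sub>n / (b)\<^sub>n\<close>, whose growth forces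
  \<open>q = p + 1\<close> and \<open>Y \<le> 1\<close>. The recursion \<open>E[Y\<^bsup>z+1\<^esup>] = \<Prod> (a + z) / (b + z) * E[Y\<^sup>z]\<close> extends from
  integers to real \<open>z \<ge> 0\<close>, since both sides are bounded linear functionals of \<open>y \<mapsto> y\<^sup>z\<close> on
  \<open>C[0, 1]\<close> and polynomials are dense there. Hence \<open>E[Y\<^sup>z]\<close> is the corresponding quotient of
  Gamma functions, and its derivative at \<open>0\<close> gives \<open>E[ln \<bar>X\<bar>]\<close>; in particular this is finite.

  With \<open>Cin u = \<integral>\<^sub>0\<^sup>u (1 - cos v) / v dv\<close>, Fubini gives
  \<open>\<integral>\<^sub>0\<^sup>R (1 - F \<xi>) / \<xi> d\<xi> = E[Cin (R \<bar>X\<bar>)]\<close>, and \<open>Cin u - ln u\<close> tends to Euler's constant, so that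
  \<open>\<integral>\<^sub>0\<^sup>R (1 - F \<xi>) / \<xi> d\<xi> - ln R\<close> tends to \<open>\<gamma> + E[ln \<bar>X\<bar>]\<close>.
\<close>

text \<open>The tail integral of \<open>F \<xi> / \<xi>\<close> is controlled not by decay of
  \<open>F\<close> but by writing the integrand as \<open>1 / \<xi> - (1 - F \<xi>) / \<xi>\<close>:
  the two logarithmic divergences cancel, and what stays is finite because
  \<open>E[ln \<bar>X\<bar>]\<close> is.

  The obstacle is that the hypothesis speaks only about integer moments, whereas
  \<open>E[ln Y]\<close> is a derivative of \<open>E[Y\<^sup>z]\<close> at \<open>z = 0\<close>. Two
  devices bridge this. Writing \<open>(a + z) / (b + z) = 1 + (a - b) / (b + z)\<close> turns each
  factor of the recursion into a bounded operator on \<open>C[0, 1]\<close>, namely the identity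
  plus a multiple of an average over dilations. The recursion at real \<open>z\<close> would still
  allow a factor of period 1; monotonicity of \<open>z \<mapsto> E[Y\<^sup>z]\<close> removes it.

  Origin of the constants: the parameter \<open>1/2\<close> contributes
  \<open>\<psi>(1/2) = - \<gamma> - 2 ln 2\<close>, and the scaling by \<open>1/4\<close> in
  \<open>Y\<close> contributes a compensating \<open>ln 4\<close>, so \<open>2 E[ln \<bar>X\<bar>] =
  - \<gamma> + \<Sum> \<psi>(a) - \<Sum> \<psi>(b)\<close>. Together with the
  \<open>2 \<gamma>\<close> coming from \<open>Cin\<close> this leaves the single
  \<open>- \<gamma>\<close> of the theorem.\<close>

section \<open>Even moments from the cosine transform\<close>

text \<open>Fatou bounds the integral of \<open>v\<close> by \<open>l\<close> before
  \<open>v\<close> is known to be integrable; once it is, \<open>v\<close> itself is the majorant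
  for dominated convergence. This serves limits that lie above their approximations:
  \<open>V X\<^sup>2\<close> and \<open>- ln Y\<close>.\<close>

lemma fatou_dominated:
  fixes u :: "nat \<Rightarrow> 'a \<Rightarrow> real"
  assumes u: "\<And>n. integrable M (u n)" and v: "v \<in> borel_measurable M"
    and bounds: "\<And>n. AE x in M. 0 \<le> u n x \<and> u n x \<le> v x"
    and conv: "AE x in M. (\<lambda>n. u n x) \<longlonglongrightarrow> v x"
    and lim: "(\<lambda>n. integral\<^sup>L M (u n)) \<longlonglongrightarrow> l"
  shows "integrable M v" "integral\<^sup>L M v = l"
proof -
  have [measurable]: "u n \<in> borel_measurable M" for n using u by auto
  note v[measurable]
  have ae: "AE x in M. \<forall>n. 0 \<le> u n x \<and> u n x \<le> v x"
    using bounds by (simp add: AE_all_countable)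
  have "(\<integral>\<^sup>+x. ennreal (v x) \<partial>M) = (\<integral>\<^sup>+x. liminf (\<lambda>n. ennreal (u n x)) \<partial>M)"
  proof (rule nn_integral_cong_AE)
    show "AE x in M. ennreal (v x) = liminf (\<lambda>n. ennreal (u n x))"
      using conv
      by eventually_elim (intro lim_imp_Liminf[symmetric] tendsto_ennrealI, auto)
  qed
  also have "\<dots> \<le> liminf (\<lambda>n. \<integral>\<^sup>+x. ennreal (u n x) \<partial>M)"
    by (rule nn_integral_liminf) auto
  also have "(\<lambda>n. \<integral>\<^sup>+x. ennreal (u n x) \<partial>M) = (\<lambda>n. ennreal (integral\<^sup>L M (u n)))"
  proof
    fix n
    have "AE x in M. 0 \<le> u n x" using bounds[of n] by auto
    then show "(\<integral>\<^sup>+x. ennreal (u n x) \<partial>M) = ennreal (integral\<^sup>L M (u n))"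
      using nn_integral_eq_integral[OF u[of n]] by blast
  qed
  also have "liminf \<dots> = ennreal l"
    by (intro lim_imp_Liminf tendsto_ennrealI lim) auto
  finally have fin: "(\<integral>\<^sup>+x. ennreal (v x) \<partial>M) < \<infinity>"
    by (metis ennreal_less_top infinity_ennreal_def order_le_less_trans)
  have nonneg: "AE x in M. 0 \<le> v x" using ae by eventually_elim (auto intro: order_trans)
  have "(\<integral>\<^sup>+x. ennreal (norm (v x)) \<partial>M) = (\<integral>\<^sup>+x. ennreal (v x) \<partial>M)"
    using nonneg by (intro nn_integral_cong_AE) auto
  with fin show int: "integrable M v"
    by (subst integrable_iff_bounded) auto
  have "(\<lambda>n. integral\<^sup>L M (u n)) \<longlonglongrightarrow> integral\<^sup>L M v"
  proof (rule integral_dominated_convergence[OF _ _ int conv])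
    show "AE x in M. norm (u n x) \<le> v x" for n
      using bounds[of n] by eventually_elim auto
  qed auto
  then show "integral\<^sup>L M v = l"
    using lim LIMSEQ_unique by blast
qed

text \<open>Taylor expansion of the even function \<open>t \<mapsto> g (s + t) + g (s - t)\<close>
  has no linear term, so the Lagrange remainder of order two is the whole difference
  quotient.\<close>

lemma second_difference_LIMSEQ:
  fixes g g' g'' :: "real \<Rightarrow> real"
  assumes g: "\<And>s. (g has_real_derivative g' s) (at s)"
    and g': "\<And>s. (g' has_real_derivative g'' s) (at s)"
    and cont: "isCont g'' s"
    and h: "\<And>n. h n > 0" "h \<longlonglongrightarrow> 0"
  shows "(\<lambda>n. (2 * g s - g (s + h n) - g (s - h n)) / (h n)\<^sup>2) \<longlonglongrightarrow> - g'' s"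
proof -
  have "\<exists>t. 0 < t \<and> t \<le> h n \<and>
      (2 * g s - g (s + h n) - g (s - h n)) / (h n)\<^sup>2 = - (g'' (s + t) + g'' (s - t)) / 2" for n
  proof -
    define diff where "diff = (\<lambda>m::nat. if m = 0 then (\<lambda>t. g (s + t) + g (s - t))
      else if m = 1 then (\<lambda>t. g' (s + t) - g' (s - t)) else (\<lambda>t. g'' (s + t) + g'' (s - t)))"
    have "((\<lambda>t. g (s + t) + g (s - t)) has_real_derivative (g' (s + t) - g' (s - t))) (at t)" for t
      by (auto intro!: derivative_eq_intros DERIV_chain2[OF g] simp: field_simps)
    moreover have "((\<lambda>t. g' (s + t) - g' (s - t)) has_real_derivative (g'' (s + t) + g'' (s - t))) (at t)" for t
      by (auto intro!: derivative_eq_intros DERIV_chain2[OF g'] simp: field_simps)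
    ultimately have "\<forall>m t. m < 2 \<and> 0 \<le> t \<and> t \<le> h n \<longrightarrow> DERIV (diff m) t :> diff (Suc m) t"
      by (auto simp: diff_def less_2_cases_iff)
    from Maclaurin2[OF h(1)[of n] refl this] obtain t where t: "0 < t" "t \<le> h n"
      "diff 0 (h n) = (\<Sum>m<2. diff m 0 / fact m * h n ^ m) + diff 2 t / fact 2 * (h n)\<^sup>2"
      by blast
    then have "g (s + h n) + g (s - h n) = 2 * g s + (g'' (s + t) + g'' (s - t)) / 2 * (h n)\<^sup>2"
      by (simp add: diff_def numeral_2_eq_2)
    then have "(2 * g s - g (s + h n) - g (s - h n)) = - (g'' (s + t) + g'' (s - t)) / 2 * (h n)\<^sup>2"
      by (simp add: field_simps)
    then show ?thesis
      using t h(1)[of n] by (intro exI[of _ t]) (simp add: field_simps)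
  qed
  then obtain t where t: "\<And>n. 0 < t n" "\<And>n. t n \<le> h n"
    "\<And>n. (2 * g s - g (s + h n) - g (s - h n)) / (h n)\<^sup>2 = - (g'' (s + t n) + g'' (s - t n)) / 2"
    by metis
  have "t \<longlonglongrightarrow> 0"
    by (rule tendsto_sandwich[OF _ _ tendsto_const h(2)]) (use t in \<open>auto intro!: always_eventually less_imp_le\<close>)
  then have "(\<lambda>n. s + t n) \<longlonglongrightarrow> s" "(\<lambda>n. s - t n) \<longlonglongrightarrow> s"
    by (auto intro!: tendsto_eq_intros)
  then have "(\<lambda>n. - (g'' (s + t n) + g'' (s - t n)) / 2) \<longlonglongrightarrow> - (g'' s + g'' s) / 2"
    using cont by (intro tendsto_intros isCont_tendsto_compose[OF cont]) auto
  moreover have "- (g'' s + g'' s) / 2 = - g'' s" by simp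
  ultimately show ?thesis unfolding t(3) by metis
qed

lemma one_minus_cos_le: "1 - cos (y::real) \<le> y\<^sup>2 / 2"
proof -
  have "\<bar>sin (y/2)\<bar> \<le> \<bar>y/2\<bar>" by (rule abs_sin_x_le_abs_x)
  then have "(sin (y/2))\<^sup>2 \<le> (y/2)\<^sup>2" by (rule abs_le_square_iff[THEN iffD1])
  moreover have "cos y = 1 - 2 * (sin (y/2))\<^sup>2" using cos_double_sin[of "y/2"] by simp
  ultimately show ?thesis by (simp add: field_simps)
qed

lemma two_minus_two_cos_LIMSEQ:
  fixes h :: "nat \<Rightarrow> real"
  assumes h: "\<And>n. h n > 0" "h \<longlonglongrightarrow> 0"
  shows "(\<lambda>n. (2 - 2 * cos (h n * y)) / (h n)\<^sup>2) \<longlonglongrightarrow> y\<^sup>2"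
proof -
  have "(\<lambda>n. (2 * cos (0 * y) - cos ((0 + h n) * y) - cos ((0 - h n) * y)) / (h n)\<^sup>2)
      \<longlonglongrightarrow> - (- cos (0 * y) * y\<^sup>2)"
    by (rule second_difference_LIMSEQ[where g = "\<lambda>s. cos (s * y)" and g' = "\<lambda>s. - sin (s * y) * y"
          and g'' = "\<lambda>s. - cos (s * y) * y\<^sup>2" and s = 0 and h = h, OF _ _ _ h])
      (auto intro!: derivative_eq_intros continuous_intros simp: power2_eq_square)
  then show ?thesis by simp
qed

text \<open>
  A symmetric second difference of \<open>s \<mapsto> E[V cos (s X)]\<close> multiplies the integrand by
  \<open>(2 - 2 cos (h X)) / h\<^sup>2\<close>, which is at most \<open>X\<^sup>2\<close> and tends to it; at \<open>s = 0\<close> Fatou therefore yields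
  integrability of \<open>V X\<^sup>2\<close> before anything is known about the moments.
\<close>
lemma weighted_cos_transform_second_derivative:
  fixes X V :: "'a \<Rightarrow> real"
  assumes X[measurable]: "X \<in> borel_measurable M"
    and V: "integrable M V" "\<And>w. V w \<ge> 0"
    and tr: "\<And>s. (\<integral>w. V w * cos (s * X w) \<partial>M) = g s"
    and g: "\<And>s. (g has_real_derivative g' s) (at s)"
    and g': "\<And>s. (g' has_real_derivative g'' s) (at s)"
    and cont: "\<And>s. isCont g'' s"
  shows "integrable M (\<lambda>w. V w * (X w)\<^sup>2)"
    and "(\<integral>w. V w * (X w)\<^sup>2 * cos (s * X w) \<partial>M) = - g'' s"
proof -
  have [measurable]: "V \<in> borel_measurable M" using V by auto
  define h :: "nat \<Rightarrow> real" where "h n = 1 / (real n + 1)" for n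
  have h: "\<And>n. h n > 0" "h \<longlonglongrightarrow> 0"
    unfolding h_def using LIMSEQ_inverse_real_of_nat by (auto simp: inverse_eq_divide add.commute)
  define u where "u n w = (2 - 2 * cos (h n * X w)) / (h n)\<^sup>2" for n w
  have u_m[measurable]: "u n \<in> borel_measurable M" for n unfolding u_def by measurable
  have u0: "0 \<le> u n w" for n w by (simp add: u_def)
  have u1: "u n w \<le> (X w)\<^sup>2" for n w
    using one_minus_cos_le[of "h n * X w"] h(1)[of n]
    by (simp add: u_def power_mult_distrib divide_le_eq mult.commute)
  have ulim: "(\<lambda>n. u n w) \<longlonglongrightarrow> (X w)\<^sup>2" for w
    unfolding u_def by (rule two_minus_two_cos_LIMSEQ[OF h])
  have Vcos: "integrable M (\<lambda>w. V w * cos (s * X w))" for s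
    by (rule Bochner_Integration.integrable_bound[OF V(1)])
      (auto simp: abs_mult V(2) mult_left_le)
  have ident: "V w * u n w * cos (s * X w) =
      (2 * (V w * cos (s * X w)) - V w * cos ((s + h n) * X w) - V w * cos ((s - h n) * X w)) / (h n)\<^sup>2" for n w s
    by (simp add: u_def ring_distribs cos_add cos_diff)
  have D: "integrable M (\<lambda>w. V w * u n w * cos (s * X w))"
    "(\<integral>w. V w * u n w * cos (s * X w) \<partial>M) = (2 * g s - g (s + h n) - g (s - h n)) / (h n)\<^sup>2" for n s
  proof -
    show "integrable M (\<lambda>w. V w * u n w * cos (s * X w))"
      unfolding ident by (intro Bochner_Integration.integrable_divide Bochner_Integration.integrable_diff
          integrable_mult_right Vcos)
    show "(\<integral>w. V w * u n w * cos (s * X w) \<partial>M) = (2 * g s - g (s + h n) - g (s - h n)) / (h n)\<^sup>2"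
      unfolding ident tr[symmetric]
      by (simp add: Bochner_Integration.integral_diff Bochner_Integration.integrable_diff Vcos)
  qed
  have lim: "(\<lambda>n. \<integral>w. V w * u n w * cos (s * X w) \<partial>M) \<longlonglongrightarrow> - g'' s" for s
    unfolding D by (rule second_difference_LIMSEQ[OF g g' cont h])
  show int: "integrable M (\<lambda>w. V w * (X w)\<^sup>2)"
  proof (rule fatou_dominated(1))
    show "integrable M (\<lambda>w. V w * u n w)" for n using D(1)[of n 0] by simp
    show "(\<lambda>n. \<integral>w. V w * u n w \<partial>M) \<longlonglongrightarrow> - g'' 0" using lim[of 0] by simp
    show "AE w in M. 0 \<le> V w * u n w \<and> V w * u n w \<le> V w * (X w)\<^sup>2" for n
      using u0 u1 V(2) by (auto intro!: mult_left_mono)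
    show "AE w in M. (\<lambda>n. V w * u n w) \<longlonglongrightarrow> V w * (X w)\<^sup>2"
      by (intro AE_I2 tendsto_mult tendsto_const ulim)
  qed measurable
  have "(\<lambda>n. \<integral>w. V w * u n w * cos (s * X w) \<partial>M) \<longlonglongrightarrow> (\<integral>w. V w * (X w)\<^sup>2 * cos (s * X w) \<partial>M)"
  proof (rule integral_dominated_convergence[OF _ _ int])
    show "AE w in M. norm (V w * u n w * cos (s * X w)) \<le> V w * (X w)\<^sup>2" for n
    proof (rule AE_I2)
      fix w
      have "norm (V w * u n w * cos (s * X w)) \<le> V w * u n w * 1"
        unfolding norm_mult using u0[of n w] V(2)[of w] by (intro mult_mono) auto
      also have "\<dots> \<le> V w * (X w)\<^sup>2" using u1[of n w] V(2)[of w] by (simp add: mult_left_mono)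
      finally show "norm (V w * u n w * cos (s * X w)) \<le> V w * (X w)\<^sup>2" .
    qed
    show "AE w in M. (\<lambda>n. V w * u n w * cos (s * X w)) \<longlonglongrightarrow> V w * (X w)\<^sup>2 * cos (s * X w)"
      by (intro AE_I2 tendsto_mult tendsto_const ulim)
  qed measurable
  with lim[of s] show "(\<integral>w. V w * (X w)\<^sup>2 * cos (s * X w) \<partial>M) = - g'' s"
    using LIMSEQ_unique by blast
qed

lemma (in prob_space) even_moments_from_cos_transform:
  fixes X :: "'a \<Rightarrow> real" and g :: "nat \<Rightarrow> real \<Rightarrow> real"
  assumes X[measurable]: "X \<in> borel_measurable M"
    and tr: "\<And>s. expectation (\<lambda>w. cos (s * X w)) = g 0 s"
    and g: "\<And>n s. (g n has_real_derivative g (Suc n) s) (at s)"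
  shows "integrable M (\<lambda>w. X w ^ (2 * n))"
    and "expectation (\<lambda>w. X w ^ (2 * n)) = (-1) ^ n * g (2 * n) 0"
proof -
  \<comment> \<open>The induction has to carry the transform for all \<open>s\<close>, not only the
    moment at \<open>s = 0\<close>, since the next step differentiates it twice.\<close>
  have "integrable M (\<lambda>w. X w ^ (2 * n)) \<and>
    (\<forall>s. expectation (\<lambda>w. X w ^ (2 * n) * cos (s * X w)) = (-1) ^ n * g (2 * n) s)"
  proof (induction n)
    case 0
    then show ?case using tr by simp
  next
    case (Suc n)
    note * = weighted_cos_transform_second_derivative[where V = "\<lambda>w. X w ^ (2 * n)" and X = X and M = M
        and g = "\<lambda>s. (-1) ^ n * g (2 * n) s" and g' = "\<lambda>s. (-1) ^ n * g (Suc (2 * n)) s"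
        and g'' = "\<lambda>s. (-1) ^ n * g (Suc (Suc (2 * n))) s", OF X]
    have eq: "X w ^ (2 * n) * (X w)\<^sup>2 = X w ^ (2 * Suc n)" for w
      by (simp add: power2_eq_square)
    show ?case
      using *[OF conjunct1[OF Suc.IH] _ conjunct2[OF Suc.IH, rule_format] DERIV_cmult[OF g] DERIV_cmult[OF g]]
        DERIV_isCont[OF g] unfolding eq by simp
  qed
  from conjunct1[OF this] conjunct2[OF this, rule_format, of 0]
  show "integrable M (\<lambda>w. X w ^ (2 * n))"
    "expectation (\<lambda>w. X w ^ (2 * n)) = (-1) ^ n * g (2 * n) 0" by auto
qed

section \<open>Bounded functionals on continuous functions of the unit interval\<close>

text \<open>A bounded linear functional on \<open>C[0, 1]\<close>, encoded on total functions: the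
  laws are demanded only for functions continuous on the interval, and an arbitrary bound
  \<open>e\<close> replaces the supremum norm.\<close>

definition bounded_functional :: "((real \<Rightarrow> real) \<Rightarrow> real) \<Rightarrow> bool" where
  "bounded_functional L \<longleftrightarrow>
     (\<forall>g h. continuous_on {0..1} g \<longrightarrow> continuous_on {0..1} h \<longrightarrow> L (\<lambda>y. g y + h y) = L g + L h) \<and>
     (\<forall>c g. continuous_on {0..1} g \<longrightarrow> L (\<lambda>y. c * g y) = c * L g) \<and>
     (\<exists>C. \<forall>g e. continuous_on {0..1} g \<longrightarrow> (\<forall>y\<in>{0..1}. \<bar>g y\<bar> \<le> e) \<longrightarrow> \<bar>L g\<bar> \<le> C * e)"

lemma
  assumes "bounded_functional L" and "continuous_on {0..1} g"
  shows bounded_functional_add: "continuous_on {0..1} h \<Longrightarrow> L (\<lambda>y. g y + h y) = L g + L h"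
    and bounded_functional_cmult: "L (\<lambda>y. c * g y) = c * L g"
  using assms by (auto simp: bounded_functional_def)

lemma bounded_functional_bound:
  assumes "bounded_functional L"
  obtains C where "\<And>g e. continuous_on {0..1} g \<Longrightarrow> (\<forall>y\<in>{0..1}. \<bar>g y\<bar> \<le> e) \<Longrightarrow> \<bar>L g\<bar> \<le> C * e"
  using assms unfolding bounded_functional_def by meson

text \<open>The bound with \<open>e = 0\<close>, applied to the difference, shows that
  \<open>L\<close> cannot see values outside the interval.\<close>

lemma bounded_functional_cong:
  assumes L: "bounded_functional L" and g: "continuous_on {0..1} g"
    and eq: "\<And>y. y \<in> {0..1} \<Longrightarrow> g y = h y"
  shows "L g = L h"
proof -
  have h: "continuous_on {0..1} h"
    using g by (rule continuous_on_eq) (use eq in auto)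
  have d: "continuous_on {0..1} (\<lambda>y. g y + (- 1) * h y)"
    by (intro continuous_intros g h)
  obtain C where C: "\<And>g e. continuous_on {0..1} g \<Longrightarrow> (\<forall>y\<in>{0..1}. \<bar>g y\<bar> \<le> e) \<Longrightarrow> \<bar>L g\<bar> \<le> C * e"
    using bounded_functional_bound[OF L] by blast
  have "\<bar>L (\<lambda>y. g y + (- 1) * h y)\<bar> \<le> C * 0"
    by (rule C[OF d]) (use eq in auto)
  moreover have "L (\<lambda>y. g y + (- 1) * h y) = L g + (- 1) * L h"
    using bounded_functional_add[OF L g, of "\<lambda>y. (- 1) * h y"] bounded_functional_cmult[OF L h, of "-1"] h
    by (simp add: continuous_on_minus)
  ultimately show ?thesis by simp
qed

lemma bounded_functional_eq_zero:
  assumes L: "bounded_functional L" and mono: "\<And>n::nat. L (\<lambda>y. y ^ n) = 0"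
    and g: "continuous_on {0..1} g"
  shows "L g = 0"
proof -
  obtain C where C: "\<And>g e. continuous_on {0..1} g \<Longrightarrow> (\<forall>y\<in>{0..1}. \<bar>g y\<bar> \<le> e) \<Longrightarrow> \<bar>L g\<bar> \<le> C * e"
    using bounded_functional_bound[OF L] by blast
  have poly: "L (\<lambda>y. \<Sum>i\<le>n. a i * y ^ i) = 0" for a :: "nat \<Rightarrow> real" and n
  proof (induction n)
    case 0
    then show ?case
      using bounded_functional_cmult[OF L, of "\<lambda>y. y ^ 0" "a 0"] mono[of 0] by (simp add: continuous_intros)
  next
    case (Suc n)
    have "L (\<lambda>y. (\<Sum>i\<le>n. a i * y ^ i) + a (Suc n) * y ^ Suc n)
        = L (\<lambda>y. \<Sum>i\<le>n. a i * y ^ i) + L (\<lambda>y. a (Suc n) * y ^ Suc n)"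
      by (intro bounded_functional_add[OF L] continuous_intros)
    also have "L (\<lambda>y. a (Suc n) * y ^ Suc n) = a (Suc n) * L (\<lambda>y. y ^ Suc n)"
      by (intro bounded_functional_cmult[OF L] continuous_intros)
    finally show ?case using Suc mono[of "Suc n"] by simp
  qed
  have bound: "\<bar>L g\<bar> \<le> C * e" if e: "e > 0" for e
  proof -
    obtain p where p: "real_polynomial_function p" "\<And>y. y \<in> {0..1} \<Longrightarrow> \<bar>g y - p y\<bar> < e"
      using Stone_Weierstrass_real_polynomial_function[OF compact_Icc g e] by blast
    have p0: "L p = 0"
      using p(1) poly unfolding real_polynomial_function_iff_sum by blast
    have cp: "continuous_on {0..1} p"
      using p(1) continuous_on_polymonial_function real_polynomial_function_eq by blast
    have cd: "continuous_on {0..1} (\<lambda>y. g y - p y)"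
      by (intro continuous_intros g cp)
    have "L (\<lambda>y. p y + (g y - p y)) = L p + L (\<lambda>y. g y - p y)"
      by (rule bounded_functional_add[OF L cp cd])
    then have "L g = L (\<lambda>y. g y - p y)" using p0 by simp
    also have "\<bar>\<dots>\<bar> \<le> C * e"
      using p(2) by (intro C[OF cd]) (auto intro: less_imp_le)
    finally show ?thesis .
  qed
  show ?thesis
  proof (rule ccontr)
    assume "L g \<noteq> 0"
    then have pos: "\<bar>L g\<bar> > 0" by simp
    \<comment> \<open>The constant of the bound comes without a sign. Here it must be positive, and
      then \<open>e = \<bar>L g\<bar> / (2 * C)\<close> would halve
      \<open>\<bar>L g\<bar>\<close>.\<close>
    have "0 < C * 1" using bound[of 1] pos by linarith
    then have C0: "C > 0" by simp
    have "\<bar>L g\<bar> \<le> C * (\<bar>L g\<bar> / (2 * C))" by (rule bound) (use pos C0 in simp)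
    then show False using pos C0 by simp
  qed
qed

text \<open>
  \<open>power_fun z\<close> is \<open>y \<mapsto> y\<^sup>z\<close> with \<open>0\<^sup>0 = 1\<close>, unlike \<^const>\<open>powr\<close>; this keeps the zeroth moment
  continuous at \<open>0\<close>.
\<close>
definition power_fun :: "real \<Rightarrow> real \<Rightarrow> real" where
  "power_fun z y = (if z = 0 then 1 else y powr z)"

lemma power_fun_of_nat: "y \<ge> 0 \<Longrightarrow> power_fun (real n) y = y ^ n"
  by (cases "y = 0") (auto simp: power_fun_def powr_realpow)

lemma power_fun_add_one: "y \<ge> 0 \<Longrightarrow> z \<ge> 0 \<Longrightarrow> power_fun (z + 1) y = y * power_fun z y"
  by (cases "y = 0") (auto simp: power_fun_def powr_add)

lemma continuous_on_power_fun: "z \<ge> 0 \<Longrightarrow> continuous_on {0..1} (power_fun z)"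
proof (cases "z = 0")
  case False
  assume "z \<ge> 0"
  with False have z: "z > 0" by simp
  then have "power_fun z = (\<lambda>y. y powr z)" by (simp add: power_fun_def fun_eq_iff)
  moreover have "continuous_on {0..1} (\<lambda>y::real. y powr z)"
    by (rule continuous_on_powr') (use z in \<open>auto intro: continuous_intros\<close>)
  ultimately show ?thesis by simp
qed (simp add: power_fun_def[abs_def])

text \<open>
  After the substitution \<open>u = v powr (1 / b)\<close> this is \<open>g \<mapsto> \<integral>\<^sub>0\<^sup>1 u powr (b - 1) * g (u * y) du\<close>, which
  multiplies \<open>y powr z\<close> by \<open>1 / (b + z)\<close>.
\<close>
definition dilation_average :: "real \<Rightarrow> (real \<Rightarrow> real) \<Rightarrow> real \<Rightarrow> real" where
  "dilation_average b g y = integral {0..1} (\<lambda>v. g (v powr (1 / b) * y)) / b"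

lemma dilation_range:
  fixes y v b :: real
  assumes "b > 0" "y \<in> {0..1}" "v \<in> {0..1}"
  shows "v powr (1 / b) * y \<in> {0..1}"
proof -
  have "v powr (1 / b) \<le> 1"
    using powr_mono2[of "1 / b" v 1] assms by auto
  then show ?thesis using assms by (auto intro: mult_le_one)
qed

lemma continuous_on_dilation:
  fixes g :: "real \<Rightarrow> real" and b :: real
  assumes "b > 0" "continuous_on {0..1} g"
  shows "continuous_on ({0..1} \<times> {0..1}) (\<lambda>(y, v). g (v powr (1 / b) * y))"
  unfolding case_prod_beta
  by (rule continuous_on_compose2[OF assms(2)])
    (use assms(1) dilation_range[OF assms(1)] in \<open>auto intro!: continuous_intros continuous_on_powr'\<close>)

lemma continuous_on_dilation_average:
  fixes g :: "real \<Rightarrow> real" and b :: real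
  assumes "b > 0" "continuous_on {0..1} g"
  shows "continuous_on {0..1} (dilation_average b g)"
  unfolding dilation_average_def
  using integral_continuous_on_param[of "{0..1::real}" 0 1 "\<lambda>y v. g (v powr (1 / b) * y)"]
    continuous_on_dilation[OF assms] assms(1)
  by (auto intro!: continuous_intros)

lemma integrable_dilation:
  fixes g :: "real \<Rightarrow> real" and b :: real
  assumes "b > 0" "continuous_on {0..1} g" "y \<in> {0..1}"
  shows "(\<lambda>v. g (v powr (1 / b) * y)) integrable_on {0..1}"
proof (rule integrable_continuous_real)
  show "continuous_on {0..1} (\<lambda>v. g (v powr (1 / b) * y))"
    by (rule continuous_on_compose2[OF assms(2)])
      (use assms(1) dilation_range[OF assms(1,3)] in \<open>auto intro!: continuous_intros continuous_on_powr'\<close>)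
qed

lemma dilation_average_power_fun:
  assumes b: "b > 0" and z: "z \<ge> 0" and y: "y \<ge> 0"
  shows "dilation_average b (power_fun z) y = 1 / (b + z) * power_fun z y"
proof -
  have "((\<lambda>v. v powr (z / b)) has_integral (1 powr (z / b + 1) / (z / b + 1))) {0..1}"
    using b z by (intro has_integral_powr_from_0) (auto intro: less_le_trans[of _ 0])
  then have "((\<lambda>v. v powr (z / b) * power_fun z y) has_integral (1 / (z / b + 1) * power_fun z y)) {0..1}"
    by (intro has_integral_mult_left) simp
  \<comment> \<open>The point \<open>v = 0\<close> is exempted because for \<open>z = 0\<close> the
    power \<open>0 powr 0\<close> is 0 while \<open>power_fun 0 0\<close> is 1.\<close>
  then have "((\<lambda>v. power_fun z (v powr (1 / b) * y)) has_integral (1 / (z / b + 1) * power_fun z y)) {0..1}"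
    by (rule has_integral_spike_finite[of "{0}", rotated 2])
      (use y in \<open>auto simp: power_fun_def powr_mult powr_powr\<close>)
  then have "dilation_average b (power_fun z) y = 1 / (z / b + 1) * power_fun z y / b"
    by (simp add: dilation_average_def integral_unique)
  also have "\<dots> = 1 / (b + z) * power_fun z y"
    using b z by (simp add: field_simps add_nonneg_eq_0_iff)
  finally show ?thesis .
qed

text \<open>\<open>dilation_average b\<close> preserves continuity on the interval and turns a bound
  \<open>e\<close> into \<open>e / b\<close>, so composing with it keeps a functional
  bounded.\<close>

lemma bounded_functional_dilation:
  assumes L: "bounded_functional L" and b: "b > 0"
  shows "bounded_functional (\<lambda>g. L g + c * L (dilation_average b g))"
proof -
  obtain C where C: "\<And>g e. continuous_on {0..1} g \<Longrightarrow> (\<forall>y\<in>{0..1}. \<bar>g y\<bar> \<le> e) \<Longrightarrow> \<bar>L g\<bar> \<le> C * e"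
    using bounded_functional_bound[OF L] by blast
  have add: "L (dilation_average b (\<lambda>y. g y + h y)) = L (dilation_average b g) + L (dilation_average b h)"
    if g: "continuous_on {0..1} g" and h: "continuous_on {0..1} h" for g h
  proof -
    have "L (dilation_average b (\<lambda>y. g y + h y)) = L (\<lambda>y. dilation_average b g y + dilation_average b h y)"
    proof (rule bounded_functional_cong[OF L])
      show "continuous_on {0..1} (dilation_average b (\<lambda>y. g y + h y))"
        by (intro continuous_on_dilation_average b continuous_intros g h)
      show "dilation_average b (\<lambda>y. g y + h y) y = dilation_average b g y + dilation_average b h y"
        if "y \<in> {0..1}" for y
        unfolding dilation_average_def
        by (subst Henstock_Kurzweil_Integration.integral_add)
          (auto intro!: integrable_dilation b g h simp: add_divide_distrib that[simplified])
    qed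
    also have "\<dots> = L (dilation_average b g) + L (dilation_average b h)"
      by (intro bounded_functional_add[OF L] continuous_on_dilation_average b g h)
    finally show ?thesis .
  qed
  have scale: "L (dilation_average b (\<lambda>y. k * g y)) = k * L (dilation_average b g)"
    if g: "continuous_on {0..1} g" for k g
  proof -
    have "dilation_average b (\<lambda>y. k * g y) = (\<lambda>y. k * dilation_average b g y)"
      by (simp add: dilation_average_def fun_eq_iff)
    then show ?thesis
      by (simp add: bounded_functional_cmult[OF L] continuous_on_dilation_average b g)
  qed
  have bound: "\<bar>L g + c * L (dilation_average b g)\<bar> \<le> (C + \<bar>c\<bar> * (C / b)) * e"
    if g: "continuous_on {0..1} g" and e: "\<forall>y\<in>{0..1}. \<bar>g y\<bar> \<le> e" for g :: "real \<Rightarrow> real" and e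
  proof -
    have "\<bar>dilation_average b g y\<bar> \<le> e / b" if y: "y \<in> {0..1}" for y
    proof -
      have "norm (integral {0..1} (\<lambda>v. g (v powr (1 / b) * y))) \<le> integral {0..1} (\<lambda>v::real. e)"
        by (rule Henstock_Kurzweil_Integration.integral_norm_bound_integral[OF integrable_dilation[OF b g y]])
          (use e dilation_range[OF b y] in auto)
      then show ?thesis using b by (simp add: dilation_average_def divide_right_mono)
    qed
    then have "\<bar>L (dilation_average b g)\<bar> \<le> C * (e / b)"
      by (intro C continuous_on_dilation_average b g) auto
    then have "\<bar>c\<bar> * \<bar>L (dilation_average b g)\<bar> \<le> \<bar>c\<bar> * (C * (e / b))"
      by (rule mult_left_mono) simp
    moreover have "\<bar>L g\<bar> \<le> C * e" by (intro C g e)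
    ultimately have "\<bar>L g\<bar> + \<bar>c * L (dilation_average b g)\<bar> \<le> C * e + \<bar>c\<bar> * (C * (e / b))"
      by (simp add: abs_mult)
    then have "\<bar>L g + c * L (dilation_average b g)\<bar> \<le> C * e + \<bar>c\<bar> * (C * (e / b))"
      by (rule order_trans[OF abs_triangle_ineq])
    then show ?thesis by (simp add: algebra_simps)
  qed
  show ?thesis
    unfolding bounded_functional_def
  proof (intro conjI allI impI exI[of _ "C + \<bar>c\<bar> * (C / b)"])
    show "\<bar>L g + c * L (dilation_average b g)\<bar> \<le> (C + \<bar>c\<bar> * (C / b)) * e"
      if "continuous_on {0..1} g" "\<forall>y\<in>{0..1}. \<bar>g y\<bar> \<le> e" for g e
      using bound that by blast
  qed (simp_all add: add scale bounded_functional_add[OF L] bounded_functional_cmult[OF L] ring_distribs)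
qed

text \<open>Since \<open>(a + z) / (b + z) = 1 + (a - b) / (b + z)\<close>, one factor is realised
  by adding \<open>a - b\<close> times the composition with \<open>dilation_average b\<close>; the
  list is processed factor by factor. The right-hand side of the moment recursion thereby becomes a
  bounded functional, which is determined by its values on monomials.\<close>

lemma ex_functional_with_multiplier:
  fixes ps :: "(real \<times> real) list"
  assumes L: "bounded_functional L" and ps: "\<forall>(a, b)\<in>set ps. b > 0"
  shows "\<exists>L'. bounded_functional L' \<and>
    (\<forall>z\<ge>0. L' (power_fun z) = (\<Prod>(a, b)\<leftarrow>ps. (a + z) / (b + z)) * L (power_fun z))"
  using ps
proof (induction ps)
  case Nil
  then show ?case using L by (intro exI[of _ L]) auto
next
  case (Cons p ps)
  obtain a b where p: "p = (a, b)" by force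
  with Cons.prems have b: "b > 0" by auto
  from Cons obtain L' where L': "bounded_functional L'"
    "\<And>z. z \<ge> 0 \<Longrightarrow> L' (power_fun z) = (\<Prod>(a, b)\<leftarrow>ps. (a + z) / (b + z)) * L (power_fun z)"
    by auto
  show ?case
  proof (intro exI conjI allI impI)
    show "bounded_functional (\<lambda>g. L' g + (a - b) * L' (dilation_average b g))"
      by (rule bounded_functional_dilation[OF L'(1) b])
    fix z :: real assume z: "z \<ge> 0"
    have "L' (dilation_average b (power_fun z)) = L' (\<lambda>y. 1 / (b + z) * power_fun z y)"
      by (rule bounded_functional_cong[OF L'(1)])
        (use dilation_average_power_fun[OF b z] in
          \<open>auto intro!: continuous_on_dilation_average continuous_on_power_fun b z\<close>)
    also have "\<dots> = 1 / (b + z) * L' (power_fun z)"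
      by (rule bounded_functional_cmult[OF L'(1) continuous_on_power_fun[OF z]])
    finally have "L' (power_fun z) + (a - b) * L' (dilation_average b (power_fun z))
        = (1 + (a - b) / (b + z)) * L' (power_fun z)"
      by (simp add: ring_distribs)
    also have "1 + (a - b) / (b + z) = (a + z) / (b + z)"
      using b z by (simp add: field_simps)
    finally show "L' (power_fun z) + (a - b) * L' (dilation_average b (power_fun z))
        = (\<Prod>(a, b)\<leftarrow>p # ps. (a + z) / (b + z)) * L (power_fun z)"
      by (simp add: p L'(2)[OF z])
  qed
qed

lemma bounded_functional_diff:
  assumes "bounded_functional L" "bounded_functional L'"
  shows "bounded_functional (\<lambda>g. L g - L' g)"
proof -
  obtain C where C: "\<And>g e. continuous_on {0..1} g \<Longrightarrow> (\<forall>y\<in>{0..1}. \<bar>g y\<bar> \<le> e) \<Longrightarrow> \<bar>L g\<bar> \<le> C * e"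
    using bounded_functional_bound[OF assms(1)] by blast
  obtain C' where C': "\<And>g e. continuous_on {0..1} g \<Longrightarrow> (\<forall>y\<in>{0..1}. \<bar>g y\<bar> \<le> e) \<Longrightarrow> \<bar>L' g\<bar> \<le> C' * e"
    using bounded_functional_bound[OF assms(2)] by blast
  show ?thesis
    unfolding bounded_functional_def
  proof (intro conjI allI impI exI[of _ "C + C'"])
    fix g :: "real \<Rightarrow> real" and e :: real assume "continuous_on {0..1} g" "\<forall>y\<in>{0..1}. \<bar>g y\<bar> \<le> e"
    from C[OF this] C'[OF this] show "\<bar>L g - L' g\<bar> \<le> (C + C') * e"
      by (simp add: ring_distribs)
  qed (simp_all add: bounded_functional_add[OF assms(1)] bounded_functional_cmult[OF assms(1)]
      bounded_functional_add[OF assms(2)] bounded_functional_cmult[OF assms(2)] ring_distribs)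
qed

lemma (in prob_space) bounded_functional_expectation:
  assumes [measurable]: "Y \<in> borel_measurable M" "V \<in> borel_measurable M"
    and Y: "\<And>w. Y w \<in> {0..1}" and V: "\<And>w. \<bar>V w\<bar> \<le> 1"
  shows "bounded_functional (\<lambda>g. expectation (\<lambda>w. V w * g (Y w)))"
proof -
  have int: "integrable M (\<lambda>w. V w * g (Y w))" if g: "continuous_on {0..1} g" for g
  proof -
    \<comment> \<open>Clamping the argument extends \<open>g\<close> continuously to the whole line,
      which gives measurability; nothing is known about \<open>g\<close> outside the
      interval.\<close>
    have "continuous_on UNIV (\<lambda>y. g (max 0 (min 1 y)))"
      by (rule continuous_on_compose2[OF g]) (auto intro!: continuous_intros)
    then have "(\<lambda>y. g (max 0 (min 1 y))) \<in> borel_measurable borel"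
      by (rule borel_measurable_continuous_onI)
    then have "(\<lambda>w. g (max 0 (min 1 (Y w)))) \<in> borel_measurable M"
      by (rule measurable_compose[rotated]) simp
    also have "(\<lambda>w. g (max 0 (min 1 (Y w)))) = (\<lambda>w. g (Y w))"
      using Y by (auto simp: fun_eq_iff)
    finally have [measurable]: "(\<lambda>w. g (Y w)) \<in> borel_measurable M" .
    obtain B where B: "\<And>y. y \<in> {0..1} \<Longrightarrow> \<bar>g y\<bar> \<le> B"
      using compact_imp_bounded[OF compact_continuous_image[OF g compact_Icc]]
      unfolding bounded_iff by force
    show ?thesis
    proof (rule integrable_const_bound[of _ "1 * B"])
      show "AE w in M. norm (V w * g (Y w)) \<le> 1 * B"
        unfolding real_norm_def abs_mult using V B[OF Y]
        by (intro AE_I2 mult_mono) (auto intro: order_trans[OF abs_ge_zero])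
    qed measurable
  qed
  show ?thesis
    unfolding bounded_functional_def
  proof (intro conjI allI impI exI[of _ 1])
    fix g :: "real \<Rightarrow> real" and e :: real assume g: "continuous_on {0..1} g" and e: "\<forall>y\<in>{0..1}. \<bar>g y\<bar> \<le> e"
    have "\<bar>expectation (\<lambda>w. V w * g (Y w))\<bar> \<le> expectation (\<lambda>w. \<bar>V w * g (Y w)\<bar>)"
      by (rule integral_abs_bound)
    also have "\<dots> \<le> expectation (\<lambda>w. e)"
    proof (intro integral_mono integrable_abs int g)
      fix w
      have "\<bar>V w * g (Y w)\<bar> \<le> 1 * e"
        unfolding abs_mult using V[of w] e Y[of w] by (intro mult_mono) auto
      then show "\<bar>V w * g (Y w)\<bar> \<le> e" by simp
    qed simp
    finally show "\<bar>expectation (\<lambda>w. V w * g (Y w))\<bar> \<le> 1 * e" by (simp add: prob_space)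
  next
    fix c :: real and g :: "real \<Rightarrow> real" assume "continuous_on {0..1} g"
    then show "expectation (\<lambda>w. V w * (c * g (Y w))) = c * expectation (\<lambda>w. V w * g (Y w))"
      by (simp add: mult.left_commute[of _ c])
  qed (simp add: ring_distribs int)
qed

section \<open>Limits of Pochhammer quotients and of products over lists\<close>

lemma pochhammer_ratio_LIMSEQ:
  fixes a b t :: real
  assumes "a > 0" "b > 0" "t \<ge> 0"
  shows "(\<lambda>n. (pochhammer a n / pochhammer b n) / (pochhammer (a + t) n / pochhammer (b + t) n))
    \<longlonglongrightarrow> Gamma (a + t) / Gamma a * (Gamma b / Gamma (b + t))"
proof (rule Lim_transform_eventually)
  have lim: "Gamma_series' x \<longlonglongrightarrow> Gamma x" if "x > 0" for x :: real
    using that Gamma_series'_LIMSEQ by auto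
  have nz: "Gamma x \<noteq> 0" if "x > 0" for x :: real
    using Gamma_real_pos[OF that] by simp
  \<comment> \<open>Each \<open>Gamma_series' x n\<close> contains a power \<open>n powr x\<close>.
    Upper and lower parameter are shifted by the same \<open>t\<close>, so these powers cancel and
    only Pochhammer symbols remain.\<close>
  show "(\<lambda>n. Gamma_series' (a + t) n / Gamma_series' a n * (Gamma_series' b n / Gamma_series' (b + t) n))
      \<longlonglongrightarrow> Gamma (a + t) / Gamma a * (Gamma b / Gamma (b + t))"
    using assms by (intro tendsto_intros lim nz) auto
  show "\<forall>\<^sub>F n in sequentially. Gamma_series' (a + t) n / Gamma_series' a n * (Gamma_series' b n / Gamma_series' (b + t) n)
     = (pochhammer a n / pochhammer b n) / (pochhammer (a + t) n / pochhammer (b + t) n)"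
    using eventually_gt_at_top[of 0]
  proof eventually_elim
    case (elim n)
    have p: "pochhammer x n \<noteq> 0" if "x > 0" for x :: real using pochhammer_pos[OF that, of n] by simp
    have nz': "pochhammer a n \<noteq> 0" "pochhammer b n \<noteq> 0" "pochhammer (a + t) n \<noteq> 0" "pochhammer (b + t) n \<noteq> 0"
      using assms by (auto intro!: p)
    show ?case using nz'
      by (simp add: Gamma_series'_def ring_distribs exp_add field_simps)
  qed
qed

lemma prod_list_pos: "(\<And>x. x \<in> set xs \<Longrightarrow> f x > 0) \<Longrightarrow> (\<Prod>x\<leftarrow>xs. f x :: real) > 0"
  by (induction xs) auto

lemma tendsto_prod_list:
  fixes f :: "'a \<Rightarrow> 'b \<Rightarrow> real"
  shows "(\<And>x. x \<in> set xs \<Longrightarrow> (f x \<longlongrightarrow> l x) F) \<Longrightarrow> ((\<lambda>n. \<Prod>x\<leftarrow>xs. f x n) \<longlongrightarrow> (\<Prod>x\<leftarrow>xs. l x)) F"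
  by (induction xs) (auto intro!: tendsto_mult)

section \<open>The logarithmic moment from the integer moments\<close>

lemma (in prob_space) power_fun_moment_step:
  fixes ps :: "(real \<times> real) list"
  assumes [measurable]: "Y \<in> borel_measurable M" and Y: "\<And>w. Y w \<in> {0..1}"
    and ps: "\<forall>(a, b)\<in>set ps. b > 0"
    and mom: "\<And>n. expectation (\<lambda>w. Y w ^ n) = (\<Prod>(a, b)\<leftarrow>ps. pochhammer a n / pochhammer b n)"
    and z: "z \<ge> 0"
  shows "expectation (\<lambda>w. power_fun (z + 1) (Y w)) =
    (\<Prod>(a, b)\<leftarrow>ps. (a + z) / (b + z)) * expectation (\<lambda>w. power_fun z (Y w))"
proof -
  define L0 where "L0 g = (expectation (\<lambda>w. 1 * g (Y w)) :: real)" for g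
  \<comment> \<open>The weight \<open>Y\<close> raises the exponent by one, so
    \<open>L1 (power_fun z)\<close> is the moment of order \<open>z + 1\<close>.\<close>
  define L1 where "L1 g = (expectation (\<lambda>w. Y w * g (Y w)) :: real)" for g
  have L0: "bounded_functional L0" and L1: "bounded_functional L1"
    unfolding L0_def L1_def using Y by (intro bounded_functional_expectation; auto)+
  obtain L where L: "bounded_functional L"
    "\<And>z. z \<ge> 0 \<Longrightarrow> L (power_fun z) = (\<Prod>(a, b)\<leftarrow>ps. (a + z) / (b + z)) * L0 (power_fun z)"
    using ex_functional_with_multiplier[OF L0 ps] by blast
  have prod_Suc: "(\<Prod>(a, b)\<leftarrow>ps. pochhammer a (Suc n) / pochhammer b (Suc n)) =
      (\<Prod>(a, b)\<leftarrow>ps. (a + real n) / (b + real n)) * (\<Prod>(a, b)\<leftarrow>ps. pochhammer a n / pochhammer b n)" for n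
    by (induction ps) (auto simp: pochhammer_Suc algebra_simps)
  have "L1 (power_fun z) - L (power_fun z) = 0"
  proof (rule bounded_functional_eq_zero[OF bounded_functional_diff[OF L1 L(1)] _ continuous_on_power_fun[OF z]])
    fix n :: nat
    have cong: "L' (power_fun (real n)) = L' (\<lambda>y. y ^ n)" if "bounded_functional L'" for L'
      by (rule bounded_functional_cong[OF that]) (auto intro!: continuous_on_power_fun simp: power_fun_of_nat)
    have "L (\<lambda>y. y ^ n) = (\<Prod>(a, b)\<leftarrow>ps. (a + real n) / (b + real n)) * L0 (\<lambda>y. y ^ n)"
      using L(2)[of "real n"] by (simp add: cong L0 L(1))
    also have "L0 (\<lambda>y. y ^ n) = (\<Prod>(a, b)\<leftarrow>ps. pochhammer a n / pochhammer b n)"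
      using mom[of n] by (simp add: L0_def)
    also have "(\<Prod>(a, b)\<leftarrow>ps. (a + real n) / (b + real n)) * \<dots> = L1 (\<lambda>y. y ^ n)"
      using mom[of "Suc n"] by (simp add: L1_def prod_Suc)
    finally show "L1 (\<lambda>y. y ^ n) - L (\<lambda>y. y ^ n) = 0" by simp
  qed
  moreover have "L1 (power_fun z) = expectation (\<lambda>w. power_fun (z + 1) (Y w))"
    unfolding L1_def using Y z by (intro Bochner_Integration.integral_cong) (auto simp: power_fun_add_one)
  ultimately show ?thesis
    using L(2)[OF z] by (simp add: L0_def)
qed

text \<open>The argument is of Bohr-Mollerup type, with monotonicity in place of log-convexity. For
  \<open>0 \<le> t \<le> 1\<close> the moment of order \<open>n + t\<close> lies between those of
  orders \<open>n + 1\<close> and \<open>n\<close>, whose quotient \<open>R n\<close> tends to 1.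
  Iterating the recursion from \<open>0\<close> and from \<open>t\<close> then expresses the moment
  of order \<open>t\<close> by Pochhammer quotients in the limit.\<close>

lemma (in prob_space) power_fun_moment:
  fixes ps :: "(real \<times> real) list"
  assumes [measurable]: "Y \<in> borel_measurable M" and Y: "\<And>w. Y w \<in> {0..1}"
    and ps: "\<forall>(a, b)\<in>set ps. a > 0 \<and> b > 0"
    and mom: "\<And>n. expectation (\<lambda>w. Y w ^ n) = (\<Prod>(a, b)\<leftarrow>ps. pochhammer a n / pochhammer b n)"
    and t: "0 \<le> t" "t \<le> 1"
  shows "expectation (\<lambda>w. power_fun t (Y w)) =
    (\<Prod>(a, b)\<leftarrow>ps. Gamma (a + t) / Gamma a * (Gamma b / Gamma (b + t)))"
proof -
  define \<phi> where "\<phi> z = expectation (\<lambda>w. power_fun z (Y w))" for z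
  define R where "R z = (\<Prod>(a, b)\<leftarrow>ps. (a + z) / (b + z))" for z
  have step: "\<phi> (z + 1) = R z * \<phi> z" if "z \<ge> 0" for z
    unfolding \<phi>_def R_def using ps by (intro power_fun_moment_step mom Y that) auto
  have iter: "\<phi> (z + real n) = (\<Prod>(a, b)\<leftarrow>ps. pochhammer (a + z) n / pochhammer (b + z) n) * \<phi> z"
    if "z \<ge> 0" for z n
  proof (induction n)
    case 0
    then show ?case by (induction ps) auto
  next
    case (Suc n)
    have "\<phi> (z + real (Suc n)) = R (z + real n) * \<phi> (z + real n)"
      using step[of "z + real n"] that by (simp add: algebra_simps)
    moreover have "(\<Prod>(a, b)\<leftarrow>ps. pochhammer (a + z) (Suc n) / pochhammer (b + z) (Suc n)) =
        R (z + real n) * (\<Prod>(a, b)\<leftarrow>ps. pochhammer (a + z) n / pochhammer (b + z) n)"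
      unfolding R_def by (induction ps) (auto simp: pochhammer_Suc algebra_simps)
    ultimately show ?case using Suc by simp
  qed
  have \<phi>0: "\<phi> 0 = 1" by (simp add: \<phi>_def power_fun_def prob_space)
  have [measurable]: "power_fun z \<in> borel_measurable borel" for z
    unfolding power_fun_def by measurable
  have int: "integrable M (\<lambda>w. power_fun z (Y w))" if "z \<ge> 0" for z
  proof (rule integrable_const_bound[of _ 1])
    have "\<bar>power_fun z (Y w)\<bar> \<le> 1" for w
      using Y[of w] that powr_mono2[of z "Y w" 1] by (auto simp: power_fun_def)
    then show "AE w in M. norm (power_fun z (Y w)) \<le> 1" by simp
  qed measurable
  have anti: "\<phi> z' \<le> \<phi> z" if "z \<le> z'" "z > 0" for z z'
    unfolding \<phi>_def
  proof (intro integral_mono int)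
    fix w show "power_fun z' (Y w) \<le> power_fun z (Y w)"
      using that Y[of w] by (cases "Y w = 0") (auto simp: power_fun_def intro!: powr_mono')
  qed (use that in auto)
  have \<phi>n: "\<phi> (real n) = (\<Prod>(a, b)\<leftarrow>ps. pochhammer a n / pochhammer b n)" for n
    using iter[of 0 n] by (simp add: \<phi>0)
  have \<phi>n_pos: "\<phi> (real n) > 0" for n
    unfolding \<phi>n using ps by (intro prod_list_pos) (auto intro!: divide_pos_pos pochhammer_pos)
  have Rlim: "(\<lambda>n. R (real n)) \<longlonglongrightarrow> 1"
  proof -
    have "(\<lambda>n. \<Prod>p\<leftarrow>ps. (fst p + real n) / (snd p + real n)) \<longlonglongrightarrow> (\<Prod>p\<leftarrow>ps. 1)"
      by (rule tendsto_prod_list) real_asymp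
    moreover have "(\<Prod>p\<leftarrow>ps. 1 :: real) = 1" by (induction ps) auto
    ultimately show ?thesis by (simp add: R_def case_prod_beta')
  qed
  have ratio: "(\<lambda>n. \<phi> (t + real n) / \<phi> (real n)) \<longlonglongrightarrow> 1"
  proof (rule tendsto_sandwich[OF _ _ Rlim tendsto_const])
    show "\<forall>\<^sub>F n in sequentially. R (real n) \<le> \<phi> (t + real n) / \<phi> (real n)"
      using eventually_gt_at_top[of 0]
    proof eventually_elim
      case (elim n)
      have "R (real n) * \<phi> (real n) \<le> \<phi> (t + real n)"
        using step[of "real n"] anti[of "t + real n" "real n + 1"] t elim by auto
      then show ?case using \<phi>n_pos[of n] by (simp add: pos_le_divide_eq)
    qed
    show "\<forall>\<^sub>F n in sequentially. \<phi> (t + real n) / \<phi> (real n) \<le> 1"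
      using eventually_gt_at_top[of 0]
    proof eventually_elim
      case (elim n)
      then show ?case using anti[of "real n" "t + real n"] \<phi>n_pos[of n] t by simp
    qed
  qed
  have prod_div: "(\<Prod>p\<leftarrow>ps. f p / g p) = (\<Prod>p\<leftarrow>ps. f p) / (\<Prod>p\<leftarrow>ps. g p)" for f g :: "real \<times> real \<Rightarrow> real"
    by (induction ps) auto
  define Q where "Q n = (\<Prod>(a, b)\<leftarrow>ps. (pochhammer a n / pochhammer b n) / (pochhammer (a + t) n / pochhammer (b + t) n))" for n
  \<comment> \<open>By \<open>iter\<close>, \<open>Q n\<close> equals
    \<open>\<phi> n * \<phi> t / \<phi> (t + n)\<close>, so the product is constant in
    \<open>n\<close> while its first factor tends to 1.\<close>
  have eq: "\<phi> (t + real n) / \<phi> (real n) * Q n = \<phi> t" for n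
  proof -
    have "(\<Prod>(a, b)\<leftarrow>ps. pochhammer (a + t) n / pochhammer (b + t) n) > 0"
      using ps t by (intro prod_list_pos) (auto intro!: divide_pos_pos pochhammer_pos add_pos_nonneg)
    moreover have "Q n = \<phi> (real n) / (\<Prod>(a, b)\<leftarrow>ps. pochhammer (a + t) n / pochhammer (b + t) n)"
      unfolding Q_def \<phi>n case_prod_beta' by (rule prod_div)
    ultimately show ?thesis
      using \<phi>n_pos[of n] t by (simp add: iter)
  qed
  have "Q \<longlonglongrightarrow> (\<Prod>(a, b)\<leftarrow>ps. Gamma (a + t) / Gamma a * (Gamma b / Gamma (b + t)))"
    unfolding Q_def case_prod_beta' using ps t
    by (intro tendsto_prod_list pochhammer_ratio_LIMSEQ) auto
  from tendsto_mult[OF ratio this] show ?thesis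
    unfolding eq by (simp add: \<phi>_def LIMSEQ_const_iff)
qed

text \<open>Every factor equals 1 at \<open>t = 0\<close>, so the product rule just adds the
  logarithmic derivatives.\<close>

lemma has_real_derivative_Gamma_quotients:
  fixes ps :: "(real \<times> real) list"
  assumes "\<forall>(a, b)\<in>set ps. a > 0 \<and> b > 0"
  shows "((\<lambda>t. \<Prod>(a, b)\<leftarrow>ps. Gamma (a + t) / Gamma a * (Gamma b / Gamma (b + t)))
    has_real_derivative (\<Sum>(a, b)\<leftarrow>ps. Digamma a - Digamma b)) (at 0)"
proof -
  let ?f = "\<lambda>a b t. Gamma (a + t) / Gamma a * (Gamma b / Gamma (b + t)) :: real"
  have Gamma_nz: "Gamma x \<noteq> 0" if "x > 0" for x :: real
    using Gamma_real_pos[OF that] by simp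
  show ?thesis using assms
  proof (induction ps)
    case (Cons p ps)
    obtain a b where p: "p = (a, b)" by force
    have ab: "a > 0" "b > 0" using Cons.prems p by auto
    then have nz: "Gamma a \<noteq> 0" "Gamma b \<noteq> 0" "a \<notin> \<int>\<^sub>\<le>\<^sub>0" "b \<notin> \<int>\<^sub>\<le>\<^sub>0"
      by (auto simp: Gamma_nz)
    have val: "(\<Prod>(a, b)\<leftarrow>ps. ?f a b 0) = 1" using Cons.prems
    proof (induction ps)
      case (Cons p ps)
      then show ?case by (auto simp: Gamma_nz)
    qed simp
    have 1: "(?f a b has_real_derivative (Digamma a - Digamma b)) (at 0)"
      using nz by (auto intro!: derivative_eq_intros simp: field_simps)
    have 2: "((\<lambda>t. \<Prod>(a, b)\<leftarrow>ps. ?f a b t) has_real_derivative (\<Sum>(a, b)\<leftarrow>ps. Digamma a - Digamma b)) (at 0)"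
      using Cons by auto
    have "?f a b 0 = 1" using nz by simp
    with DERIV_mult[OF 1 2] val
    have "((\<lambda>t. ?f a b t * (\<Prod>(a, b)\<leftarrow>ps. ?f a b t)) has_real_derivative
        (Digamma a - Digamma b) + (\<Sum>(a, b)\<leftarrow>ps. Digamma a - Digamma b)) (at 0)"
      by (simp only: mult_1_right)
    then show ?case by (simp add: p)
  qed simp
qed

lemma LIMSEQ_difference_quotient_at_0:
  fixes f :: "real \<Rightarrow> real"
  assumes "(f has_real_derivative D) (at 0)"
  shows "(\<lambda>n. (f (1 / real (Suc n)) - f 0) / (1 / real (Suc n))) \<longlonglongrightarrow> D"
proof -
  have "((\<lambda>h. (f h - f 0) / h) \<longlongrightarrow> D) (at 0)"
    using assms by (simp add: has_field_derivative_iff)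
  moreover have "filterlim (\<lambda>n. 1 / real (Suc n)) (at 0) sequentially"
    using LIMSEQ_inverse_real_of_nat by (auto simp: filterlim_at inverse_eq_divide)
  ultimately show ?thesis by (rule filterlim_compose)
qed

lemma difference_quotient_powr:
  fixes y t :: real
  assumes "y > 0" "t > 0"
  shows "ln y \<le> (y powr t - 1) / t" "(\<lambda>n. (y powr (1 / real (Suc n)) - 1) / (1 / real (Suc n))) \<longlonglongrightarrow> ln y"
proof -
  have "1 + t * ln y \<le> y powr t"
    using exp_ge_add_one_self[of "t * ln y"] assms by (simp add: powr_def)
  then show "ln y \<le> (y powr t - 1) / t"
    using assms by (simp add: pos_le_divide_eq algebra_simps)
  have "((\<lambda>t. y powr t) has_real_derivative ln y) (at 0)"
    using assms by (auto intro!: derivative_eq_intros)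
  from LIMSEQ_difference_quotient_at_0[OF this]
  show "(\<lambda>n. (y powr (1 / real (Suc n)) - 1) / (1 / real (Suc n))) \<longlonglongrightarrow> ln y"
    using assms by simp
qed

text \<open>
  Pointwise, \<open>0 \<le> (1 - Y\<^sup>t) / t \<le> - ln Y\<close> with convergence as \<open>t \<rightarrow> 0\<close>, so that differentiating
  \<open>E[Y\<^sup>t]\<close> at \<open>0\<close> yields the integrability of \<open>ln Y\<close> as well.
\<close>
lemma (in prob_space) expectation_ln_eq_Digamma_sum:
  fixes ps :: "(real \<times> real) list"
  assumes Y_m[measurable]: "Y \<in> borel_measurable M" and Y: "AE w in M. 0 < Y w \<and> Y w \<le> 1"
    and ps: "\<forall>(a, b)\<in>set ps. a > 0 \<and> b > 0"
    and mom: "\<And>n. expectation (\<lambda>w. Y w ^ n) = (\<Prod>(a, b)\<leftarrow>ps. pochhammer a n / pochhammer b n)"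
  shows "integrable M (\<lambda>w. ln (Y w))"
    and "expectation (\<lambda>w. ln (Y w)) = (\<Sum>(a, b)\<leftarrow>ps. Digamma a - Digamma b)"
proof -
  \<comment> \<open>The moment lemmas need values in the interval everywhere, whereas
    \<open>Y\<close> has them only almost everywhere; clamping changes no expectation.\<close>
  define Z where "Z w = max 0 (min 1 (Y w))" for w
  have [measurable]: "Z \<in> borel_measurable M" unfolding Z_def by measurable
  have Z: "Z w \<in> {0..1}" for w by (simp add: Z_def)
  have ZY: "AE w in M. Z w = Y w" using Y by eventually_elim (auto simp: Z_def)
  have momZ: "expectation (\<lambda>w. Z w ^ n) = (\<Prod>(a, b)\<leftarrow>ps. pochhammer a n / pochhammer b n)" for n
    unfolding mom[symmetric] by (rule integral_cong_AE) (use ZY in auto)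
  define G where "G t = (\<Prod>(a, b)\<leftarrow>ps. Gamma (a + t) / Gamma a * (Gamma b / Gamma (b + t)))" for t
  define \<tau> where "\<tau> n = 1 / real (Suc n)" for n
  have \<tau>: "0 < \<tau> n" "\<tau> n \<le> 1" for n by (auto simp: \<tau>_def)
  have powr_mom: "expectation (\<lambda>w. Y w powr \<tau> n) = G (\<tau> n)" for n
  proof -
    have "expectation (\<lambda>w. Y w powr \<tau> n) = expectation (\<lambda>w. power_fun (\<tau> n) (Z w))"
      using \<tau>[of n] by (intro integral_cong_AE) (use ZY in \<open>auto simp: power_fun_def\<close>)
    also have "\<dots> = G (\<tau> n)"
      unfolding G_def using \<tau>[of n] by (intro power_fun_moment momZ Z ps) auto
    finally show ?thesis .
  qed
  have G0: "G 0 = 1"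
    using power_fun_moment[OF _ Z ps momZ, of 0] by (simp add: G_def power_fun_def prob_space)
  define u where "u n w = (1 - Y w powr \<tau> n) / \<tau> n" for n w
  have powr_le: "AE w in M. \<bar>Y w powr \<tau> n\<bar> \<le> 1" for n
    using Y by eventually_elim (use \<tau>[of n] in \<open>auto intro: powr_le1\<close>)
  have int_powr: "integrable M (\<lambda>w. Y w powr \<tau> n)" for n
    using powr_le[of n] by (intro integrable_const_bound[of _ 1]) auto
  have u_int: "integrable M (u n)" for n
    unfolding u_def by (intro Bochner_Integration.integrable_divide Bochner_Integration.integrable_diff int_powr) simp
  have "expectation (u n) = - ((G (\<tau> n) - G 0) / \<tau> n)" for n
    using int_powr[of n] powr_mom[of n] unfolding u_def
    by (simp add: prob_space G0 minus_divide_left)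
  moreover have "(\<lambda>n. - ((G (\<tau> n) - G 0) / \<tau> n)) \<longlonglongrightarrow> - (\<Sum>(a, b)\<leftarrow>ps. Digamma a - Digamma b)"
    unfolding \<tau>_def G_def
    by (intro tendsto_minus LIMSEQ_difference_quotient_at_0 has_real_derivative_Gamma_quotients ps)
  ultimately have lim: "(\<lambda>n. expectation (u n)) \<longlonglongrightarrow> - (\<Sum>(a, b)\<leftarrow>ps. Digamma a - Digamma b)"
    by simp
  have bounds: "AE w in M. 0 \<le> u n w \<and> u n w \<le> - ln (Y w)" for n
    using Y powr_le[of n]
  proof eventually_elim
    case (elim w)
    have "u n w = - ((Y w powr \<tau> n - 1) / \<tau> n)" unfolding u_def minus_divide_left by simp
    then have "u n w \<le> - ln (Y w)"
      using difference_quotient_powr(1)[of "Y w" "\<tau> n"] \<tau>[of n] elim by simp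
    then show ?case using elim \<tau>[of n] by (auto simp: u_def)
  qed
  have conv: "AE w in M. (\<lambda>n. u n w) \<longlonglongrightarrow> - ln (Y w)"
    using Y
  proof eventually_elim
    case (elim w)
    have "(\<lambda>n. - ((Y w powr \<tau> n - 1) / \<tau> n)) \<longlonglongrightarrow> - ln (Y w)"
      unfolding \<tau>_def using elim by (intro tendsto_minus difference_quotient_powr(2)[of _ 1]) auto
    moreover have "(\<lambda>n. u n w) = (\<lambda>n. - ((Y w powr \<tau> n - 1) / \<tau> n))"
      unfolding u_def minus_divide_left by simp
    ultimately show ?case by simp
  qed
  have "(\<lambda>w. - ln (Y w)) \<in> borel_measurable M" by measurable
  from fatou_dominated[OF u_int this bounds conv lim]
  show "integrable M (\<lambda>w. ln (Y w))" "expectation (\<lambda>w. ln (Y w)) = (\<Sum>(a, b)\<leftarrow>ps. Digamma a - Digamma b)"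
    by auto
qed

section \<open>The cosine integral\<close>

text \<open>The entire cosine integral. Division by zero gives the integrand the value 0 at
  \<open>v = 0\<close>, which is also its limit there.\<close>

definition Cin :: "real \<Rightarrow> real" where
  "Cin u = integral {0..u} (\<lambda>v. (1 - cos v) / v)"

text \<open>A linear bound, weaker near 0 than the quadratic one, but it makes a finite first moment
  of \<open>X\<close> sufficient for Fubini.\<close>

lemma abs_one_minus_cos_le: "\<bar>1 - cos (y::real)\<bar> \<le> \<bar>y\<bar>"
proof (cases "\<bar>y\<bar> \<le> 2")
  case True
  have "1 - cos y \<le> \<bar>y\<bar> * \<bar>y\<bar> / 2" using one_minus_cos_le[of y] by (simp add: power2_eq_square)
  also have "\<dots> \<le> \<bar>y\<bar> * 2 / 2" using True by (intro divide_right_mono mult_left_mono) auto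
  finally show ?thesis by simp
next
  case False
  have "1 - cos y \<le> 2" using cos_ge_minus_one[of y] by linarith
  then show ?thesis using False cos_le_one[of y] by linarith
qed

lemma one_minus_cos_quotient_bounds:
  assumes "v \<ge> 0"
  shows "0 \<le> (1 - cos v) / v" "(1 - cos (v::real)) / v \<le> 1"
proof -
  show "0 \<le> (1 - cos v) / v" using assms by simp
  show "(1 - cos v) / v \<le> 1"
    using abs_one_minus_cos_le[of v] assms by (cases "v = 0") (auto simp: field_simps)
qed

lemma continuous_on_one_minus_cos_quotient: "continuous_on UNIV (\<lambda>v::real. (1 - cos v) / v)"
proof -
  have "isCont (\<lambda>v::real. (1 - cos v) / v) v" for v
  proof (cases "v = 0")
    case True
    have "((\<lambda>v::real. (1 - cos v) / v) \<longlongrightarrow> 0) (at 0)"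
      by real_asymp
    then show ?thesis using True by (simp add: isCont_def)
  qed (auto intro!: continuous_intros)
  then show ?thesis by (simp add: continuous_on_eq_continuous_at)
qed

lemma has_integral_Cin: "((\<lambda>v. (1 - cos v) / v) has_integral Cin u) {0..u}"
  unfolding Cin_def
  by (intro integrable_integral integrable_continuous_real
      continuous_on_subset[OF continuous_on_one_minus_cos_quotient]) auto

lemma has_integral_Cin_scaled:
  assumes "R \<ge> 0"
  shows "((\<lambda>\<xi>. (1 - cos (\<xi> * y)) / \<xi>) has_integral Cin (R * \<bar>y\<bar>)) {0..R}"
proof (cases "y = 0")
  case True
  then show ?thesis by (simp add: Cin_def)
next
  case False
  have "((\<lambda>\<xi>. (1 - cos (\<bar>y\<bar> *\<^sub>R \<xi> + 0)) / (\<bar>y\<bar> *\<^sub>R \<xi> + 0)) has_integral (Cin (R * \<bar>y\<bar>) /\<^sub>R \<bar>y\<bar> ^ DIM(real)))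
      (cbox ((0 - 0) /\<^sub>R \<bar>y\<bar>) ((R * \<bar>y\<bar> - 0) /\<^sub>R \<bar>y\<bar>))"
    by (rule has_integral_affinity') (use False has_integral_Cin[of "R * \<bar>y\<bar>"] in auto)
  then have "((\<lambda>\<xi>. (1 - cos (\<bar>y\<bar> * \<xi>)) / (\<bar>y\<bar> * \<xi>)) has_integral (Cin (R * \<bar>y\<bar>) / \<bar>y\<bar>)) {0..R}"
    using False by (simp add: field_simps)
  then have "((\<lambda>\<xi>. \<bar>y\<bar> * ((1 - cos (\<bar>y\<bar> * \<xi>)) / (\<bar>y\<bar> * \<xi>))) has_integral (\<bar>y\<bar> * (Cin (R * \<bar>y\<bar>) / \<bar>y\<bar>))) {0..R}"
    by (rule has_integral_mult_right)
  moreover have "cos (\<bar>y\<bar> * \<xi>) = cos (\<xi> * y)" for \<xi>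
    by (cases "y \<ge> 0") (auto simp: mult.commute)
  ultimately show ?thesis using False by simp
qed

lemma Cin_nonneg: "Cin u \<ge> 0"
  using has_integral_nonneg[OF has_integral_Cin[of u]] one_minus_cos_quotient_bounds by auto

lemma Cin_le:
  assumes "u \<ge> 0"
  shows "Cin u \<le> u"
proof (rule has_integral_le[OF has_integral_Cin[of u]])
  show "((\<lambda>_. 1) has_integral u) {0..u}" using has_integral_const_real[of "1::real" 0 u] assms by simp
qed (use one_minus_cos_quotient_bounds in auto)

lemma DERIV_Cin:
  assumes "u > 0"
  shows "(Cin has_real_derivative (1 - cos u) / u) (at u)"
proof -
  have "((\<lambda>x. integral {0..x} (\<lambda>v. (1 - cos v) / v)) has_real_derivative (1 - cos u) / u) (at u within {0..u + 1})"
    by (rule integral_has_real_derivative)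
      (use assms in \<open>auto intro: continuous_on_subset[OF continuous_on_one_minus_cos_quotient]\<close>)
  moreover have "at u within {0..u + 1} = at u"
    using assms by (intro at_within_interior) auto
  ultimately show ?thesis by (simp add: Cin_def[abs_def])
qed

lemma mono_bounded_tendsto_at_top:
  fixes f :: "real \<Rightarrow> real"
  assumes mono: "\<And>x y. a \<le> x \<Longrightarrow> x \<le> y \<Longrightarrow> f x \<le> f y" and bd: "\<And>x. a \<le> x \<Longrightarrow> f x \<le> B"
  shows "\<exists>l. (f \<longlongrightarrow> l) at_top"
proof
  have bdd: "bdd_above (f ` {a..})" using bd by (auto simp: bdd_above_def)
  show "(f \<longlongrightarrow> Sup (f ` {a..})) at_top"
  proof (rule increasing_tendsto)
    show "\<forall>\<^sub>F x in at_top. f x \<le> Sup (f ` {a..})"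
      using eventually_ge_at_top[of a] by eventually_elim (auto intro!: cSup_upper bdd)
    fix y assume "y < Sup (f ` {a..})"
    then obtain x where x: "a \<le> x" "y < f x" using less_cSup_iff[OF _ bdd] by auto
    show "\<forall>\<^sub>F x in at_top. y < f x"
      using eventually_ge_at_top[of x]
      by eventually_elim (use x mono in \<open>force intro: less_le_trans\<close>)
  qed
qed

text \<open>
  Adding the boundary term \<open>sin u / u\<close> leaves the derivative \<open>- sin u / u\<^sup>2\<close>, so that
  \<open>\<mp> 1 / u\<close> makes the function monotone.
\<close>
lemma Cin_minus_ln_bounded_convergent:
  "\<exists>K B. ((\<lambda>u. Cin u - ln u) \<longlongrightarrow> K) at_top \<and> (\<forall>u\<ge>1. \<bar>Cin u - ln u\<bar> \<le> B)"
proof -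
  define W where "W u = Cin u - ln u + sin u / u" for u
  have W: "(W has_real_derivative - sin u / u\<^sup>2) (at u)" if "u > 0" for u
    unfolding W_def using that
    by (auto intro!: derivative_eq_intros DERIV_Cin simp: field_simps power2_eq_square)
  have sin_le: "sin u / u\<^sup>2 \<le> 1 / u\<^sup>2" "- (sin u / u\<^sup>2) \<le> 1 / u\<^sup>2" for u :: real
    using divide_right_mono[OF sin_le_one[of u], of "u\<^sup>2"] divide_right_mono[of "- sin u" 1 "u\<^sup>2"] sin_ge_minus_one[of u]
    by auto
  have dec: "W y + 1 / y \<le> W x + 1 / x" if "1 \<le> x" "x \<le> y" for x y
  proof (rule DERIV_nonpos_imp_nonincreasing[OF that(2)])
    fix u assume "x \<le> u" "u \<le> y"
    with that have u: "u > 0" by simp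
    have "((\<lambda>u. W u + 1 / u) has_real_derivative (- sin u / u\<^sup>2 - 1 / u\<^sup>2)) (at u)"
      using u by (auto intro!: derivative_eq_intros W simp: field_simps power2_eq_square)
    then show "\<exists>D. ((\<lambda>u. W u + 1 / u) has_real_derivative D) (at u) \<and> D \<le> 0"
      using sin_le(2)[of u] by auto
  qed
  have inc: "W x - 1 / x \<le> W y - 1 / y" if "1 \<le> x" "x \<le> y" for x y
  proof (rule DERIV_nonneg_imp_nondecreasing[OF that(2)])
    fix u assume "x \<le> u" "u \<le> y"
    with that have u: "u > 0" by simp
    have "((\<lambda>u. W u - 1 / u) has_real_derivative (- sin u / u\<^sup>2 + 1 / u\<^sup>2)) (at u)"
      using u by (auto intro!: derivative_eq_intros W simp: field_simps power2_eq_square)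
    then show "\<exists>D. ((\<lambda>u. W u - 1 / u) has_real_derivative D) (at u) \<and> 0 \<le> D"
      using sin_le(1)[of u] by auto
  qed
  have inv: "0 \<le> 1 / x" "1 / x \<le> 1" if "1 \<le> x" for x :: real using that by auto
  have upper: "W x - 1 / x \<le> W 1 + 1" if "1 \<le> x" for x
    using dec[of 1 x] inv[OF that] that by linarith
  obtain K where K: "((\<lambda>u. W u - 1 / u) \<longlongrightarrow> K) at_top"
    using mono_bounded_tendsto_at_top[of 1 "\<lambda>u. W u - 1 / u" "W 1 + 1"] inc upper by blast
  have "((\<lambda>u::real. 1 / u - sin u / u) \<longlongrightarrow> 0) at_top" by real_asymp
  from tendsto_add[OF K this] have "((\<lambda>u. Cin u - ln u) \<longlongrightarrow> K) at_top"
    by (simp add: W_def)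
  moreover have "\<bar>Cin u - ln u\<bar> \<le> \<bar>W 1\<bar> + 2" if u: "u \<ge> 1" for u
  proof -
    have "\<bar>sin u / u\<bar> \<le> 1" using u order_trans[OF abs_sin_le_one[of u] u] by (simp add: divide_le_eq)
    moreover have "W u = Cin u - ln u + sin u / u" by (simp add: W_def)
    ultimately show ?thesis
      using dec[OF order_refl u] inc[OF order_refl u] inv[OF u] by linarith
  qed
  ultimately show ?thesis by blast
qed

text \<open>On \<open>{0..R}\<close> the integrand is nonnegative and at most
  \<open>\<bar>X\<bar>\<close>. Its norm therefore integrates over \<open>\<xi>\<close> to
  \<open>Cin (R * \<bar>X\<bar>)\<close> as well, which is at most \<open>R * \<bar>X\<bar>\<close>,
  and Fubini applies.\<close>

lemma (in prob_space) integral_one_minus_cos_transform: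
  assumes X: "integrable M X" and R: "R \<ge> 0"
  shows "(\<lambda>\<xi>. (1 - expectation (\<lambda>w. cos (\<xi> * X w))) / \<xi>) integrable_on {0..R}"
    and "integral {0..R} (\<lambda>\<xi>. (1 - expectation (\<lambda>w. cos (\<xi> * X w))) / \<xi>) = expectation (\<lambda>w. Cin (R * \<bar>X w\<bar>))"
    and "integrable M (\<lambda>w. Cin (R * \<bar>X w\<bar>))"
proof -
  have [measurable]: "X \<in> borel_measurable M" using X by auto
  interpret P: pair_sigma_finite M lborel ..
  define f where "f w \<xi> = indicator {0..R} \<xi> *\<^sub>R ((1 - cos (\<xi> * X w)) / \<xi>)" for w \<xi>
  have f_le: "norm (f w \<xi>) \<le> indicator {0..R} \<xi> * \<bar>X w\<bar>" for w \<xi>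
  proof -
    have "\<bar>1 - cos (\<xi> * X w)\<bar> / \<bar>\<xi>\<bar> \<le> \<bar>X w\<bar>"
      using abs_one_minus_cos_le[of "\<xi> * X w"] by (cases "\<xi> = 0") (auto simp: abs_mult divide_le_eq mult.commute)
    then show ?thesis by (auto simp: f_def indicator_def)
  qed
  have ind: "integrable lborel (\<lambda>\<xi>. indicator {0..R} \<xi> * c)" for c :: real
    by (intro integrable_mult_left integrable_real_indicator) (auto simp: emeasure_lborel_Icc_eq)
  have f_int: "integrable lborel (f w)" for w
  proof (rule Bochner_Integration.integrable_bound[OF ind[of "\<bar>X w\<bar>"]])
    show "f w \<in> borel_measurable lborel" unfolding f_def by measurable
    show "AE \<xi> in lborel. norm (f w \<xi>) \<le> norm (indicator {0..R} \<xi> * \<bar>X w\<bar>)"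
      using f_le[of w] by (intro AE_I2) (auto simp: abs_mult)
  qed
  have f_eq: "(\<integral>\<xi>. f w \<xi> \<partial>lborel) = Cin (R * \<bar>X w\<bar>)" for w
  proof -
    have "set_integrable lborel {0..R} (\<lambda>\<xi>. (1 - cos (\<xi> * X w)) / \<xi>)"
      using f_int[of w] by (simp add: set_integrable_def f_def[abs_def])
    from set_borel_integral_eq_integral(2)[OF this] show ?thesis
      using integral_unique[OF has_integral_Cin_scaled[OF R, of "X w"]]
      by (simp add: set_lebesgue_integral_def f_def)
  qed
  have meas: "case_prod f \<in> borel_measurable (M \<Otimes>\<^sub>M lborel)"
    unfolding f_def case_prod_beta by measurable
  have norm_f: "(\<integral>\<xi>. norm (f w \<xi>) \<partial>lborel) = Cin (R * \<bar>X w\<bar>)" for w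
    unfolding f_eq[symmetric]
    by (intro Bochner_Integration.integral_cong) (auto simp: f_def indicator_def)
  have Cin_m: "(\<lambda>w. Cin (R * \<bar>X w\<bar>)) \<in> borel_measurable M"
    unfolding norm_f[symmetric] f_def by measurable
  show Cin_int: "integrable M (\<lambda>w. Cin (R * \<bar>X w\<bar>))"
  proof (rule Bochner_Integration.integrable_bound[OF _ Cin_m])
    show "integrable M (\<lambda>w. R * \<bar>X w\<bar>)" using X by auto
    show "AE w in M. norm (Cin (R * \<bar>X w\<bar>)) \<le> norm (R * \<bar>X w\<bar>)"
      using R by (intro AE_I2) (auto simp: Cin_nonneg abs_mult intro!: Cin_le)
  qed
  have f_pair: "integrable (M \<Otimes>\<^sub>M lborel) (case_prod f)"
    by (rule P.Fubini_integrable[OF meas]) (simp_all only: case_prod_conv norm_f Cin_int f_int AE_I2)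
  have cos_int: "integrable M (\<lambda>w. cos (\<xi> * X w))" for \<xi>
    by (rule integrable_const_bound[of _ 1]) auto
  have inner: "(\<integral>w. f w \<xi> \<partial>M) = indicator {0..R} \<xi> *\<^sub>R ((1 - expectation (\<lambda>w. cos (\<xi> * X w))) / \<xi>)" for \<xi>
    unfolding f_def by (simp add: Bochner_Integration.integral_diff cos_int prob_space)
  have si: "set_integrable lborel {0..R} (\<lambda>\<xi>. (1 - expectation (\<lambda>w. cos (\<xi> * X w))) / \<xi>)"
    using P.integrable_snd[OF f_pair] unfolding set_integrable_def inner .
  show "(\<lambda>\<xi>. (1 - expectation (\<lambda>w. cos (\<xi> * X w))) / \<xi>) integrable_on {0..R}"
    by (rule set_borel_integral_eq_integral(1)[OF si])
  have "integral {0..R} (\<lambda>\<xi>. (1 - expectation (\<lambda>w. cos (\<xi> * X w))) / \<xi>)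
      = (\<integral>\<xi>. (\<integral>w. f w \<xi> \<partial>M) \<partial>lborel)"
    unfolding set_borel_integral_eq_integral(2)[OF si, symmetric] inner set_lebesgue_integral_def ..
  also have "\<dots> = (\<integral>w. (\<integral>\<xi>. f w \<xi> \<partial>lborel) \<partial>M)"
    by (rule P.Fubini_integral[OF f_pair])
  finally show "integral {0..R} (\<lambda>\<xi>. (1 - expectation (\<lambda>w. cos (\<xi> * X w))) / \<xi>) = expectation (\<lambda>w. Cin (R * \<bar>X w\<bar>))"
    unfolding f_eq .
qed

lemma (in prob_space) one_minus_cos_transform_asymptotic:
  assumes X: "integrable M X" and nz: "AE w in M. X w \<noteq> 0" and lnX: "integrable M (\<lambda>w. ln \<bar>X w\<bar>)"
    and K: "((\<lambda>u. Cin u - ln u) \<longlongrightarrow> K) at_top"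
  shows "((\<lambda>R. integral {0..R} (\<lambda>\<xi>. (1 - expectation (\<lambda>w. cos (\<xi> * X w))) / \<xi>) - ln R)
    \<longlongrightarrow> K + expectation (\<lambda>w. ln \<bar>X w\<bar>)) at_top"
proof -
  have [measurable]: "X \<in> borel_measurable M" using X by auto
  obtain B where B: "\<And>u. u \<ge> 1 \<Longrightarrow> \<bar>Cin u - ln u\<bar> \<le> B"
    using Cin_minus_ln_bounded_convergent by blast
  \<comment> \<open>Dominated convergence asks for measurability at every real \<open>R\<close>;
    \<open>max 0 R\<close> provides it and changes nothing for \<open>R \<ge> 0\<close>.\<close>
  define s where "s R w = Cin (max 0 R * \<bar>X w\<bar>) - ln R - ln \<bar>X w\<bar>" for R w
  have s_eq: "AE w in M. s R w = Cin (R * \<bar>X w\<bar>) - ln (R * \<bar>X w\<bar>)" if "R > 0" for R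
    using nz by eventually_elim (use that in \<open>auto simp: s_def ln_mult\<close>)
  have Cin_m[measurable]: "(\<lambda>w. Cin (max 0 R * \<bar>X w\<bar>)) \<in> borel_measurable M" for R
    using integral_one_minus_cos_transform(3)[OF X, of "max 0 R"] by auto
  have "((\<lambda>R. expectation (s R)) \<longlongrightarrow> expectation (\<lambda>w. K)) at_top"
  proof (rule integral_dominated_convergence_at_top[where w = "\<lambda>w. \<bar>B\<bar> + 1 + \<bar>ln \<bar>X w\<bar>\<bar>"])
    show "AE w in M. ((\<lambda>R. s R w) \<longlongrightarrow> K) at_top"
      using nz
    proof eventually_elim
      case (elim w)
      have "filterlim (\<lambda>R. R * \<bar>X w\<bar>) at_top at_top"
        using elim by (intro filterlim_at_top_mult_tendsto_pos[OF tendsto_const] filterlim_ident) auto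
      from filterlim_compose[OF K this]
      have "((\<lambda>R. Cin (R * \<bar>X w\<bar>) - ln (R * \<bar>X w\<bar>)) \<longlongrightarrow> K) at_top" .
      then show ?case
        by (rule Lim_transform_eventually)
          (rule eventually_mono[OF eventually_gt_at_top[of 0]], use elim in \<open>auto simp: s_def ln_mult\<close>)
    qed
    \<comment> \<open>Where \<open>R * \<bar>X\<bar> \<ge> 1\<close>, the bound \<open>B\<close>
      applies. Elsewhere \<open>Cin\<close> is at most 1, and
      \<open>ln \<bar>X\<bar> \<le> ln (R * \<bar>X\<bar>) \<le> 0\<close> because
      \<open>R \<ge> 1\<close>.\<close>
    show "\<forall>\<^sub>F R in at_top. AE w in M. norm (s R w) \<le> \<bar>B\<bar> + 1 + \<bar>ln \<bar>X w\<bar>\<bar>"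
      using eventually_ge_at_top[of 1]
    proof eventually_elim
      case (elim R)
      then have R: "R > 0" by simp
      show ?case using s_eq[OF R] nz
      proof eventually_elim
        case w: (elim w)
        show ?case
        proof (cases "R * \<bar>X w\<bar> \<ge> 1")
          case True
          then show ?thesis using B[OF True] w(1) abs_ge_zero[of "ln \<bar>X w\<bar>"] by (simp only: real_norm_def) linarith
        next
          case False
          have pos: "0 < R * \<bar>X w\<bar>" using R w by simp
          have "ln \<bar>X w\<bar> \<le> ln (R * \<bar>X w\<bar>)"
            using elim w by (simp add: ln_mult)
          moreover have "ln (R * \<bar>X w\<bar>) \<le> 0" using False pos by simp
          moreover have "Cin (R * \<bar>X w\<bar>) \<le> 1" using Cin_le[of "R * \<bar>X w\<bar>"] False pos by simp
          ultimately show ?thesis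
            using Cin_nonneg[of "R * \<bar>X w\<bar>"] unfolding w(1) real_norm_def by linarith
        qed
      qed
    qed
    show "s R \<in> borel_measurable M" for R unfolding s_def by measurable
    show "integrable M (\<lambda>w. \<bar>B\<bar> + 1 + \<bar>ln \<bar>X w\<bar>\<bar>)" using lnX by auto
  qed auto
  then have "((\<lambda>R. expectation (s R) + expectation (\<lambda>w. ln \<bar>X w\<bar>)) \<longlongrightarrow> K + expectation (\<lambda>w. ln \<bar>X w\<bar>)) at_top"
    by (intro tendsto_intros) (simp add: prob_space)
  then show ?thesis
  proof (rule Lim_transform_eventually)
    show "\<forall>\<^sub>F R in at_top. expectation (s R) + expectation (\<lambda>w. ln \<bar>X w\<bar>) =
      integral {0..R} (\<lambda>\<xi>. (1 - expectation (\<lambda>w. cos (\<xi> * X w))) / \<xi>) - ln R"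
      using eventually_ge_at_top[of 0]
    proof eventually_elim
      case (elim R)
      have "expectation (s R) = expectation (\<lambda>w. Cin (R * \<bar>X w\<bar>)) - ln R - expectation (\<lambda>w. ln \<bar>X w\<bar>)"
        using elim integral_one_minus_cos_transform(3)[OF X elim] lnX unfolding s_def
        by (simp add: prob_space max_absorb2)
      then show ?case
        using integral_one_minus_cos_transform(2)[OF X elim] by simp
    qed
  qed
qed



section \<open>The exponential distribution: powers, logarithm, cosine transform\<close>

abbreviation exponential_measure :: "real measure" where
  "exponential_measure \<equiv> density lborel (exponential_density 1)"

lemma prob_space_exponential_measure: "prob_space exponential_measure"
  by (rule prob_space_exponential_density) simp

lemma AE_exponential_measure_pos: "AE t in exponential_measure. t > 0"
proof -
  have "AE t in lborel. t \<noteq> (0::real)" by (rule AE_lborel_singleton)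
  then show ?thesis
    by (subst AE_density) (auto simp: exponential_density_def elim!: eventually_mono split: if_splits)
qed

lemma
  fixes s :: real
  assumes "s > -1"
  shows integrable_exponential_measure_powr: "integrable exponential_measure (\<lambda>t. t powr s)"
    and integral_exponential_measure_powr: "(\<integral>t. t powr s \<partial>exponential_measure) = Gamma (s + 1)"
proof -
  have "(\<integral>\<^sup>+t. ennreal (t powr s) \<partial>exponential_measure)
      = (\<integral>\<^sup>+t. ennreal (exponential_density 1 t) * ennreal (t powr s) \<partial>lborel)"
    by (subst nn_integral_density) auto
  also have "\<dots> = (\<integral>\<^sup>+t. ennreal (indicator {0..} t * t powr (s + 1 - 1) / exp t) \<partial>lborel)"
    by (intro nn_integral_cong)
      (auto simp: exponential_density_def indicator_def exp_minus field_simps simp flip: ennreal_mult)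
  also have "\<dots> = ennreal (Gamma (s + 1))"
    using Gamma_conv_nn_integral_real[of "s + 1"] assms by simp
  finally have eq: "(\<integral>\<^sup>+t. ennreal (t powr s) \<partial>exponential_measure) = ennreal (Gamma (s + 1))" .
  show int: "integrable exponential_measure (\<lambda>t. t powr s)"
    by (rule integrableI_nonneg) (auto simp: eq)
  have "Gamma (s + 1) > 0" using assms by (intro Gamma_real_pos) simp
  then show "(\<integral>t. t powr s \<partial>exponential_measure) = Gamma (s + 1)"
    using nn_integral_eq_integral[OF int] by (simp add: eq integral_nonneg)
qed

text \<open>The moment of order \<open>s\<close> is \<open>Gamma (1 + s)\<close>, whose derivative
  at \<open>s = 0\<close> is \<open>- euler_mascheroni\<close>; the difference quotients may be
  taken inside the integral by domination.\<close>

lemma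
  shows integrable_exponential_measure_ln: "integrable exponential_measure ln"
    and integral_exponential_measure_ln: "(\<integral>t. ln t \<partial>exponential_measure) = - euler_mascheroni"
proof -
  define \<tau> where "\<tau> n = 1 / real (Suc n)" for n
  have \<tau>: "0 < \<tau> n" "\<tau> n \<le> 1" for n by (auto simp: \<tau>_def)
  define q where "q n t = (t powr \<tau> n - 1) / \<tau> n" for n and t :: real
  \<comment> \<open>A majorant independent of \<open>n\<close>: for \<open>t \<ge> 1\<close> the
    quotient is at most \<open>ln t * t powr \<tau> n\<close>, hence at most
    \<open>t powr 2\<close>; for \<open>t < 1\<close> its modulus is at most \<open>- ln t\<close>,
    hence at most \<open>2 * t powr (- 1 / 2)\<close>. Both exponents exceed -1.\<close>
  define w where "w t = t powr 2 + 2 * t powr (- 1 / 2)" for t :: real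
  have w: "integrable exponential_measure w"
    unfolding w_def by (intro Bochner_Integration.integrable_add integrable_mult_right
        integrable_exponential_measure_powr) auto
  have q_le: "\<bar>q n t\<bar> \<le> w t" if t: "t > 0" for n t
  proof (cases "t \<ge> 1")
    case True
    have "1 - \<tau> n * ln t \<le> exp (- (\<tau> n * ln t))"
      using exp_ge_add_one_self[of "- (\<tau> n * ln t)"] by simp
    then have "(1 - \<tau> n * ln t) * t powr \<tau> n \<le> exp (- (\<tau> n * ln t)) * t powr \<tau> n"
      by (rule mult_right_mono) simp
    also have "\<dots> = 1" using t by (simp add: powr_def flip: exp_add)
    finally have "q n t \<le> ln t * t powr \<tau> n"
      using \<tau>[of n] by (simp add: q_def pos_divide_le_eq algebra_simps)
    also have "\<dots> \<le> t * t powr 1"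
      using True \<tau>[of n] ln_le_minus_one[OF t] by (intro mult_mono powr_mono) auto
    also have "\<dots> = t powr 2" using t by (simp add: power2_eq_square)
    finally have "q n t \<le> t powr 2" .
    moreover have "q n t \<ge> 0"
      unfolding q_def by (rule order_trans[OF ln_ge_zero[OF True] difference_quotient_powr(1)[OF t \<tau>(1)]])
    ultimately show ?thesis by (simp add: w_def add_increasing2)
  next
    case False
    have "- (1 / 2) * ln t = ln (t powr (- 1 / 2))" using t by (simp add: ln_powr)
    also have "\<dots> \<le> t powr (- 1 / 2)" using ln_le_minus_one[of "t powr (- 1 / 2)"] t by simp
    finally have "- ln t \<le> 2 * t powr (- 1 / 2)" by simp
    then have "- q n t \<le> 2 * t powr (- 1 / 2)"
      using difference_quotient_powr(1)[OF t \<tau>(1)[of n]] by (simp add: q_def)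
    moreover have "q n t \<le> 0"
      using False t \<tau>[of n] powr_le1[of "\<tau> n" t] by (auto simp: q_def divide_le_0_iff)
    ultimately show ?thesis by (simp add: w_def add_increasing)
  qed
  have q_lim: "(\<lambda>n. q n t) \<longlonglongrightarrow> ln t" if "t > 0" for t
    unfolding q_def \<tau>_def by (rule difference_quotient_powr(2)[OF that zero_less_one])
  have [measurable]: "q n \<in> borel_measurable borel" for n unfolding q_def by measurable
  interpret prob_space exponential_measure by (rule prob_space_exponential_measure)
  have ae_le: "AE t in exponential_measure. norm (q n t) \<le> w t" for n
    using AE_exponential_measure_pos by eventually_elim (use q_le in auto)
  have ae_lim: "AE t in exponential_measure. (\<lambda>n. q n t) \<longlonglongrightarrow> ln t"
    using AE_exponential_measure_pos by eventually_elim (rule q_lim)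
  show "integrable exponential_measure ln"
    by (rule integrable_dominated_convergence[OF _ _ w ae_lim ae_le]) auto
  have "(\<lambda>n. \<integral>t. q n t \<partial>exponential_measure) \<longlonglongrightarrow> (\<integral>t. ln t \<partial>exponential_measure)"
    by (rule integral_dominated_convergence[OF _ _ w ae_lim ae_le]) auto
  moreover have "(\<integral>t. q n t \<partial>exponential_measure) = (Gamma (1 + \<tau> n) - Gamma (1 + 0)) / \<tau> n" for n
    unfolding q_def using integral_exponential_measure_powr[of "\<tau> n"] integrable_exponential_measure_powr[of "\<tau> n"] \<tau>[of n]
    by (simp add: prob_space[simplified] add.commute)
  moreover have "(\<lambda>n. (Gamma (1 + \<tau> n) - Gamma (1 + 0)) / \<tau> n) \<longlonglongrightarrow> - euler_mascheroni"
    unfolding \<tau>_def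
    by (rule LIMSEQ_difference_quotient_at_0) (auto intro!: derivative_eq_intros)
  ultimately show "(\<integral>t. ln t \<partial>exponential_measure) = - euler_mascheroni"
    using LIMSEQ_unique by simp
qed

lemma integral_exponential_measure_cos:
  "(\<integral>t. cos (\<xi> * t) \<partial>exponential_measure) = 1 / (1 + \<xi>\<^sup>2)"
proof -
  \<comment> \<open>The antiderivative of \<open>exp (- t) * cos (\<xi> * t)\<close>: the real part
    of \<open>exp ((i * \<xi> - 1) * t) / (i * \<xi> - 1)\<close>.\<close>
  define F where "F t = exp (- t) * (\<xi> * sin (\<xi> * t) - cos (\<xi> * t)) / (1 + \<xi>\<^sup>2)" for t
  have pos: "1 + \<xi>\<^sup>2 > 0" by (simp add: add_pos_nonneg)
  interpret prob_space exponential_measure by (rule prob_space_exponential_measure)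
  have "integrable exponential_measure (\<lambda>t. cos (\<xi> * t))"
    by (rule integrable_const_bound[of _ 1]) auto
  then have "integrable lborel (\<lambda>t. exponential_density 1 t *\<^sub>R cos (\<xi> * t))"
    by (subst (asm) integrable_density) (auto simp: exponential_density_nonneg)
  moreover have ae: "AE t in lborel. exponential_density 1 t *\<^sub>R cos (\<xi> * t)
      = indicator {0<..} t *\<^sub>R (exp (- t) * cos (\<xi> * t))"
    using AE_lborel_singleton[of "0::real"]
    by eventually_elim (auto simp: exponential_density_def indicator_def)
  ultimately have int: "set_integrable lborel {0<..} (\<lambda>t. exp (- t) * cos (\<xi> * t))"
    unfolding set_integrable_def by (subst integrable_cong_AE[symmetric]) auto
  have "(\<integral>t. cos (\<xi> * t) \<partial>exponential_measure) = (\<integral>t. exponential_density 1 t *\<^sub>R cos (\<xi> * t) \<partial>lborel)"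
    by (subst integral_density) (auto simp: exponential_density_nonneg)
  also have "\<dots> = (LINT t:{0<..}|lborel. exp (- t) * cos (\<xi> * t))"
    unfolding set_lebesgue_integral_def by (rule integral_cong_AE[OF _ _ ae]) auto
  also have "\<dots> = (LBINT t=ereal 0..\<infinity>. exp (- t) * cos (\<xi> * t))"
    by (simp add: interval_integral_to_infinity_eq)
  also have "\<dots> = 0 - F 0"
  proof (rule interval_integral_FTC_integrable[where F = F])
    show "(F has_vector_derivative exp (- t) * cos (\<xi> * t)) (at t)" for t
    proof -
      have "((\<lambda>t. exp (- t) * (\<xi> * sin (\<xi> * t) - cos (\<xi> * t))) has_real_derivative
          exp (- t) * cos (\<xi> * t) * (1 + \<xi>\<^sup>2)) (at t)"
        by (auto intro!: derivative_eq_intros simp: algebra_simps power2_eq_square)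
      from DERIV_cdivide[OF this, of "1 + \<xi>\<^sup>2"] pos show ?thesis
        unfolding has_real_derivative_iff_has_vector_derivative[symmetric] F_def by simp
    qed
    show "set_integrable lborel (einterval (ereal 0) \<infinity>) (\<lambda>t. exp (- t) * cos (\<xi> * t))"
      using int by (simp add: einterval_def greaterThan_def)
    have "isCont F 0" unfolding F_def using pos by (intro continuous_intros) auto
    then show "((F \<circ> real_of_ereal) \<longlongrightarrow> F 0) (at_right (ereal 0))"
      by (auto simp: ereal_tendsto_simps isCont_def intro: filterlim_at_split[THEN iffD1, THEN conjunct2])
    have "((\<lambda>t. exp (- t) * (\<xi> * sin (\<xi> * t) - cos (\<xi> * t))) \<longlongrightarrow> 0) at_top"
    proof (rule Lim_null_comparison)
      show "((\<lambda>t. exp (- t) * (\<bar>\<xi>\<bar> + 1)) \<longlongrightarrow> 0) at_top" by real_asymp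
      have "\<bar>\<xi> * sin (\<xi> * t) - cos (\<xi> * t)\<bar> \<le> \<bar>\<xi>\<bar> + 1" for t
        using abs_triangle_ineq4[of "\<xi> * sin (\<xi> * t)" "cos (\<xi> * t)"]
          mult_left_mono[OF abs_sin_le_one[of "\<xi> * t"], of "\<bar>\<xi>\<bar>"] abs_cos_le_one[of "\<xi> * t"]
        by (simp only: abs_mult mult_1_right) linarith
      then show "\<forall>\<^sub>F t in at_top. norm (exp (- t) * (\<xi> * sin (\<xi> * t) - cos (\<xi> * t))) \<le> exp (- t) * (\<bar>\<xi>\<bar> + 1)"
        by (intro always_eventually allI) (auto simp: abs_mult)
    qed
    from tendsto_divide[OF this tendsto_const, of "1 + \<xi>\<^sup>2"] pos
    show "((F \<circ> real_of_ereal) \<longlongrightarrow> 0) (at_left \<infinity>)"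
      unfolding ereal_tendsto_simps F_def by simp
  qed auto
  also have "\<dots> = 1 / (1 + \<xi>\<^sup>2)" by (simp add: F_def)
  finally show ?thesis .
qed

text \<open>
  The value of the limit is read off from the exponential distribution, for which both sides of
  the asymptotic formula for \<open>1 - E[cos (\<xi> X)]\<close> are explicit.
\<close>
lemma Cin_minus_ln_tendsto: "((\<lambda>u. Cin u - ln u) \<longlongrightarrow> euler_mascheroni) at_top"
proof -
  obtain K where K: "((\<lambda>u. Cin u - ln u) \<longlongrightarrow> K) at_top"
    using Cin_minus_ln_bounded_convergent by blast
  interpret prob_space exponential_measure by (rule prob_space_exponential_measure)
  have X: "integrable exponential_measure (\<lambda>t. t)"
    using integrable_exponential_measure_powr[of 1] AE_exponential_measure_pos
    by (subst integrable_cong_AE[of _ _ "\<lambda>t. t powr 1"]) (auto elim!: eventually_mono)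
  have ae: "AE t in exponential_measure. ln \<bar>t\<bar> = ln t"
    using AE_exponential_measure_pos by eventually_elim simp
  have "integrable exponential_measure (\<lambda>t. ln \<bar>t\<bar>)"
    using integrable_exponential_measure_ln by (subst integrable_cong_AE[OF _ _ ae]) auto
  moreover have "AE t in exponential_measure. t \<noteq> 0"
    using AE_exponential_measure_pos by eventually_elim simp
  ultimately have "((\<lambda>R. integral {0..R} (\<lambda>\<xi>. (1 - expectation (\<lambda>t. cos (\<xi> * t))) / \<xi>) - ln R)
      \<longlongrightarrow> K + expectation (\<lambda>t. ln \<bar>t\<bar>)) at_top"
    by (intro one_minus_cos_transform_asymptotic X K)
  also have "expectation (\<lambda>t. ln \<bar>t\<bar>) = - euler_mascheroni"
    unfolding integral_exponential_measure_ln[symmetric] by (rule integral_cong_AE[OF _ _ ae]) auto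
  finally have 1: "((\<lambda>R. integral {0..R} (\<lambda>\<xi>. (1 - 1 / (1 + \<xi>\<^sup>2)) / \<xi>) - ln R)
      \<longlongrightarrow> K + - euler_mascheroni) at_top"
    by (simp only: integral_exponential_measure_cos)
  have "integral {0..R} (\<lambda>\<xi>. (1 - 1 / (1 + \<xi>\<^sup>2)) / \<xi>) = ln (1 + R\<^sup>2) / 2" if "R \<ge> 0" for R :: real
  proof (rule integral_unique)
    have "((\<lambda>\<xi>::real. (1 - 1 / (1 + \<xi>\<^sup>2)) / \<xi>) has_integral ln (1 + R\<^sup>2) / 2 - ln (1 + 0\<^sup>2) / 2) {0..R}"
    proof (rule fundamental_theorem_of_calculus[OF that])
      fix \<xi> :: real assume "\<xi> \<in> {0..R}"
      have pos: "1 + \<xi>\<^sup>2 > 0" by (simp add: add_pos_nonneg)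
      have "(1 - 1 / (1 + \<xi>\<^sup>2)) / \<xi> = \<xi> / (1 + \<xi>\<^sup>2)"
        using pos by (cases "\<xi> = 0") (auto simp: divide_simps power2_eq_square)
      then show "((\<lambda>\<xi>. ln (1 + \<xi>\<^sup>2) / 2) has_vector_derivative (1 - 1 / (1 + \<xi>\<^sup>2)) / \<xi>) (at \<xi> within {0..R})"
        unfolding has_real_derivative_iff_has_vector_derivative[symmetric] using pos
        by (auto intro!: derivative_eq_intros) (simp add: field_simps add_nonneg_eq_0_iff)
    qed
    then show "((\<lambda>\<xi>. (1 - 1 / (1 + \<xi>\<^sup>2)) / \<xi>) has_integral ln (1 + R\<^sup>2) / 2) {0..R}" by simp
  qed
  then have "\<forall>\<^sub>F R::real in at_top. integral {0..R} (\<lambda>\<xi>. (1 - 1 / (1 + \<xi>\<^sup>2)) / \<xi>) - ln R = ln (1 + R\<^sup>2) / 2 - ln R"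
    by (intro eventually_mono[OF eventually_ge_at_top[of 0]]) simp
  from Lim_transform_eventually[OF 1 this]
  have "((\<lambda>R::real. ln (1 + R\<^sup>2) / 2 - ln R) \<longlongrightarrow> K + - euler_mascheroni) at_top" .
  moreover have "((\<lambda>R::real. ln (1 + R\<^sup>2) / 2 - ln R) \<longlongrightarrow> 0) at_top" by real_asymp
  ultimately have "K + - euler_mascheroni = 0"
    using tendsto_unique[OF trivial_limit_at_top_linorder] by blast
  with K show ?thesis by simp
qed

section \<open>Hypergeometric series\<close>

text \<open>The ratio enters as a multiplier rather than a quotient of terms, so vanishing terms, as
  at argument 0, do no harm.\<close>

lemma summable_ratio_limit:
  fixes t :: "nat \<Rightarrow> real"
  assumes step: "\<And>n. t (Suc n) = r n * t n" and r: "r \<longlonglongrightarrow> l" and l: "\<bar>l\<bar> < 1"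
  shows "summable t"
proof -
  obtain c where c: "\<bar>l\<bar> < c" "c < 1" using dense[OF l] by blast
  have "\<forall>\<^sub>F n in sequentially. \<bar>r n\<bar> < c"
    by (rule order_tendstoD(2)[OF tendsto_rabs[OF r] c(1)])
  then obtain N where N: "\<And>n. n \<ge> N \<Longrightarrow> \<bar>r n\<bar> < c" by (auto simp: eventually_sequentially)
  show ?thesis
  proof (rule summable_ratio_test[OF c(2)])
    show "norm (t (Suc n)) \<le> c * norm (t n)" if "n \<ge> N" for n
      using N[OF that] by (simp add: step abs_mult mult_right_mono)
  qed
qed

text \<open>Markov's inequality for every power gives
  \<open>P(Y \<ge> r) \<le> E[Y\<^sup>n] / r\<^sup>n\<close>, and the right-hand side tends to 0
  because its successive ratios tend to \<open>l / r < 1\<close>.\<close>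

lemma (in prob_space) AE_less_of_moment_ratio:
  fixes Y :: "'a \<Rightarrow> real"
  assumes [measurable]: "Y \<in> borel_measurable M" and Y: "\<And>w. Y w \<ge> 0"
    and int: "\<And>n. integrable M (\<lambda>w. Y w ^ n)"
    and step: "\<And>n. expectation (\<lambda>w. Y w ^ Suc n) = \<rho> n * expectation (\<lambda>w. Y w ^ n)"
    and lim: "\<rho> \<longlonglongrightarrow> l" and l: "0 \<le> l" "l < r"
  shows "AE w in M. Y w < r"
proof -
  have r: "r > 0" using l by simp
  define t where "t n = expectation (\<lambda>w. Y w ^ n) / r ^ n" for n
  have "summable t"
  proof (rule summable_ratio_limit)
    show "t (Suc n) = \<rho> n / r * t n" for n unfolding t_def step using r by simp
    show "(\<lambda>n. \<rho> n / r) \<longlonglongrightarrow> l / r" using r by (intro tendsto_intros lim) simp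
    show "\<bar>l / r\<bar> < 1" using l r by simp
  qed
  then have t0: "t \<longlonglongrightarrow> 0" by (rule summable_LIMSEQ_zero)
  define A where "A = {w \<in> space M. r \<le> Y w}"
  have A[measurable]: "A \<in> sets M" unfolding A_def by measurable
  have "prob A \<le> t n" for n
  proof -
    have "prob A = expectation (indicator A)" by simp
    also have "\<dots> \<le> expectation (\<lambda>w. Y w ^ n / r ^ n)"
    proof (intro integral_mono)
      fix w assume "w \<in> space M"
      show "indicator A w \<le> Y w ^ n / r ^ n"
        using Y[of w] r power_mono[of r "Y w" n] by (auto simp: A_def indicator_def)
    next
      show "integrable M (indicator A :: 'a \<Rightarrow> real)"
        by (rule integrable_real_indicator[OF A]) (simp add: emeasure_eq_measure)
    qed (use int in simp)
    finally show ?thesis by (simp add: t_def)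
  qed
  with LIMSEQ_le_const[OF t0] have "prob A \<le> 0" by blast
  then have "prob A = 0" using measure_nonneg[of M A] by linarith
  then have "AE w in M. w \<notin> A" by (subst (asm) prob_eq_0) auto
  then show ?thesis
    using AE_space by eventually_elim (auto simp: A_def)
qed

definition pochhammer_quotient :: "real list \<Rightarrow> real list \<Rightarrow> nat \<Rightarrow> real" where
  "pochhammer_quotient as bs n = (\<Prod>a\<leftarrow>as. pochhammer a n) / (\<Prod>b\<leftarrow>bs. pochhammer b n)"

lemma pochhammer_quotient_0 [simp]: "pochhammer_quotient as bs 0 = 1"
proof -
  have "(\<Prod>a\<leftarrow>xs. 1 :: real) = 1" for xs :: "real list" by (induction xs) auto
  then show ?thesis by (simp add: pochhammer_quotient_def)
qed

lemma pochhammer_quotient_Suc: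
  "pochhammer_quotient as bs (Suc n) =
    (\<Prod>a\<leftarrow>as. a + real n) / (\<Prod>b\<leftarrow>bs. b + real n) * pochhammer_quotient as bs n"
proof -
  have "(\<Prod>a\<leftarrow>xs. pochhammer a (Suc n)) = (\<Prod>a\<leftarrow>xs. a + real n) * (\<Prod>a\<leftarrow>xs. pochhammer a n)"
    for xs :: "real list"
    by (induction xs) (auto simp: pochhammer_Suc)
  then show ?thesis by (simp add: pochhammer_quotient_def)
qed

text \<open>Each linear factor grows like \<open>n\<close>, leaving a power of \<open>1 / n\<close>
  with exponent the difference of the lengths. The limit yields both convergence of the series and
  the essential bound on \<open>Y\<close>.\<close>

lemma pochhammer_quotient_step_LIMSEQ:
  fixes as bs :: "real list"
  assumes "length as \<le> length bs"
  shows "(\<lambda>n. (\<Prod>a\<leftarrow>as. a + real n) / (\<Prod>b\<leftarrow>bs. b + real n))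
    \<longlonglongrightarrow> (if length as = length bs then 1 else 0)"
proof -
  have A: "(\<lambda>n. (\<Prod>a\<leftarrow>xs. a + real n) / real n ^ length xs) \<longlonglongrightarrow> 1" for xs :: "real list"
  proof (induction xs)
    case (Cons x xs)
    have "(\<lambda>n. (x + real n) / real n) \<longlonglongrightarrow> 1" by real_asymp
    from tendsto_mult[OF this Cons.IH] show ?case by simp
  qed simp
  have B: "(\<lambda>n. (1 / real n) ^ k) \<longlonglongrightarrow> (if k = 0 then 1 else 0)" for k
  proof -
    have "(\<lambda>n. 1 / real n) \<longlonglongrightarrow> 0" by real_asymp
    from tendsto_power[OF this, of k] show ?thesis by (cases k) auto
  qed
  have "(\<lambda>n. (\<Prod>a\<leftarrow>as. a + real n) / real n ^ length as / ((\<Prod>b\<leftarrow>bs. b + real n) / real n ^ length bs)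
      * (1 / real n) ^ (length bs - length as)) \<longlonglongrightarrow> 1 / 1 * (if length bs - length as = 0 then 1 else 0)"
    by (intro tendsto_mult tendsto_divide A B) simp
  then have "(\<lambda>n. (\<Prod>a\<leftarrow>as. a + real n) / real n ^ length as / ((\<Prod>b\<leftarrow>bs. b + real n) / real n ^ length bs)
      * (1 / real n) ^ (length bs - length as)) \<longlonglongrightarrow> (if length as = length bs then 1 else 0)"
    using assms by auto
  then show ?thesis
  proof (rule Lim_transform_eventually)
    show "\<forall>\<^sub>F n in sequentially. (\<Prod>a\<leftarrow>as. a + real n) / real n ^ length as / ((\<Prod>b\<leftarrow>bs. b + real n) / real n ^ length bs)
      * (1 / real n) ^ (length bs - length as) = (\<Prod>a\<leftarrow>as. a + real n) / (\<Prod>b\<leftarrow>bs. b + real n)"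
      using eventually_gt_at_top[of 0]
    proof eventually_elim
      case (elim n)
      have "real n ^ length bs = real n ^ length as * real n ^ (length bs - length as)"
        using assms by (simp flip: power_add)
      then show ?case using elim by (simp add: power_divide)
    qed
  qed
qed

lemma summable_hypergeometric:
  fixes as bs :: "real list" and z :: real
  assumes "length as \<le> length bs"
  shows "summable (\<lambda>n. pochhammer_quotient as bs n / fact n * z ^ n)"
proof (rule summable_ratio_limit)
  let ?\<rho> = "\<lambda>n. (\<Prod>a\<leftarrow>as. a + real n) / (\<Prod>b\<leftarrow>bs. b + real n)"
  show "pochhammer_quotient as bs (Suc n) / fact (Suc n) * z ^ Suc n =
      ?\<rho> n * (z / (real n + 1)) * (pochhammer_quotient as bs n / fact n * z ^ n)" for n
    by (simp add: pochhammer_quotient_Suc add.commute mult_ac)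
  have "(\<lambda>n. z / (real n + 1)) \<longlonglongrightarrow> 0" by real_asymp
  from tendsto_mult[OF pochhammer_quotient_step_LIMSEQ[OF assms] this]
  show "(\<lambda>n. ?\<rho> n * (z / (real n + 1))) \<longlonglongrightarrow> 0" by simp
qed simp

lemma hypergeometric_altdef:
  "hypergeometric as bs z = (\<Sum>n. pochhammer_quotient as bs n / fact n * z ^ n)" for z :: real
  by (simp add: hypergeometric_def pochhammer_quotient_def)

definition hypergeometric_primitive :: "real list \<Rightarrow> real list \<Rightarrow> real \<Rightarrow> real" where
  "hypergeometric_primitive as bs \<xi> =
    - (\<Sum>n. pochhammer_quotient as bs (Suc n) * ((- (\<xi>\<^sup>2)) ^ Suc n / (real (Suc n) * fact (Suc n)))) / 2"

lemma
  fixes as bs :: "real list"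
  assumes le: "length as \<le> length bs"
  shows summable_hypergeometric_primitive:
      "summable (\<lambda>n. pochhammer_quotient as bs (Suc n) * ((- (\<xi>\<^sup>2)) ^ Suc n / (real (Suc n) * fact (Suc n))))"
    and DERIV_hypergeometric_primitive:
      "(hypergeometric_primitive as bs has_real_derivative (1 - hypergeometric as bs (- (\<xi>\<^sup>2))) / \<xi>) (at \<xi> within S)"
proof -
  \<comment> \<open>\<open>x / 0 = 0\<close> makes \<open>u 0 = 0\<close>, and the integrand vanish at \<open>\<xi> = 0\<close> as its continuous extension does.\<close>
  define u where "u k = pochhammer_quotient as bs k / (real k * fact k)" for k
  have u_sum: "summable (\<lambda>k. u k * w ^ k)" for w :: real
  proof (rule summable_comparison_test[OF _ summable_rabs_cancel])
    show "summable (\<lambda>k. \<bar>\<bar>pochhammer_quotient as bs k / fact k * w ^ k\<bar>\<bar>)"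
      using powser_insidea[OF summable_hypergeometric[OF le, of "\<bar>w\<bar> + 1"], of w] by simp
    show "\<exists>N. \<forall>k\<ge>N. norm (u k * w ^ k) \<le> \<bar>pochhammer_quotient as bs k / fact k * w ^ k\<bar>"
    proof (intro exI[of _ 1] allI impI)
      fix k :: nat assume "1 \<le> k"
      then have "\<bar>pochhammer_quotient as bs k / fact k * w ^ k\<bar> / real k \<le> \<bar>pochhammer_quotient as bs k / fact k * w ^ k\<bar> / 1"
        by (intro divide_left_mono) auto
      then show "norm (u k * w ^ k) \<le> \<bar>pochhammer_quotient as bs k / fact k * w ^ k\<bar>"
        by (simp add: u_def abs_mult mult.commute)
    qed
  qed
  define G where "G w = (\<Sum>k. u k * w ^ k)" for w :: real
  define G' where "G' w = (\<Sum>k. diffs u k * w ^ k)" for w :: real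
  have G: "(G has_real_derivative G' w) (at w)" for w
    unfolding G_def[abs_def] G'_def by (rule termdiffs_strong_converges_everywhere[OF u_sum])
  \<comment> \<open>Differentiation cancels the \<open>1 / k\<close> in \<open>u\<close>,
    multiplication by \<open>w\<close> restores the exponent, and only the term 1 at
    \<open>k = 0\<close> is missing.\<close>
  have wG': "w * G' w = hypergeometric as bs w - 1" for w
  proof -
    have "(\<lambda>k. w * (diffs u k * w ^ k)) sums (w * G' w)"
      unfolding G'_def by (intro sums_mult summable_sums termdiff_converges_all u_sum)
    moreover have "w * (diffs u k * w ^ k) = pochhammer_quotient as bs (Suc k) / fact (Suc k) * w ^ Suc k" for k
      by (simp add: diffs_def u_def del: of_nat_Suc fact_Suc)
    ultimately have "(\<lambda>k. pochhammer_quotient as bs (Suc k) / fact (Suc k) * w ^ Suc k) sums (w * G' w)"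
      by simp
    then have "(\<lambda>k. pochhammer_quotient as bs k / fact k * w ^ k) sums (w * G' w + 1)"
      by (subst (asm) sums_Suc_iff) simp
    then show ?thesis by (simp add: hypergeometric_altdef sums_iff)
  qed
  have u_Suc: "u (Suc n) * w ^ Suc n = pochhammer_quotient as bs (Suc n) * (w ^ Suc n / (real (Suc n) * fact (Suc n)))" for n w
    by (simp add: u_def)
  show "summable (\<lambda>n. pochhammer_quotient as bs (Suc n) * ((- (\<xi>\<^sup>2)) ^ Suc n / (real (Suc n) * fact (Suc n))))"
    using summable_ignore_initial_segment[OF u_sum, of 1 "- (\<xi>\<^sup>2)"] by (simp only: u_Suc[symmetric]) simp
  have prim: "hypergeometric_primitive as bs \<xi> = - G (- (\<xi>\<^sup>2)) / 2" for \<xi>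
  proof -
    have "G (- (\<xi>\<^sup>2)) = (\<Sum>n. u (Suc n) * (- (\<xi>\<^sup>2)) ^ Suc n)"
      unfolding G_def using suminf_split_head[OF u_sum, of "- (\<xi>\<^sup>2)"] by (simp add: u_def)
    then show ?thesis by (simp only: hypergeometric_primitive_def u_Suc)
  qed
  \<comment> \<open>The inner derivative \<open>- 2 * \<xi>\<close> cancels the factor
    \<open>- 1 / 2\<close>.\<close>
  have "(hypergeometric_primitive as bs has_real_derivative \<xi> * G' (- (\<xi>\<^sup>2))) (at \<xi> within S)"
    unfolding prim[abs_def]
    by (auto intro!: derivative_eq_intros DERIV_chain2[OF G] simp: power2_eq_square)
  moreover have "\<xi> * G' (- (\<xi>\<^sup>2)) = (1 - hypergeometric as bs (- (\<xi>\<^sup>2))) / \<xi>"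
    using wG'[of "- (\<xi>\<^sup>2)"] by (cases "\<xi> = 0") (auto simp: field_simps power2_eq_square)
  ultimately show "(hypergeometric_primitive as bs has_real_derivative (1 - hypergeometric as bs (- (\<xi>\<^sup>2))) / \<xi>) (at \<xi> within S)"
    by simp
qed

lemma hypergeometric_primitive_0 [simp]: "hypergeometric_primitive as bs 0 = 0"
  by (simp add: hypergeometric_primitive_def)

lemma has_integral_hypergeometric_primitive:
  fixes as bs :: "real list"
  assumes "length as \<le> length bs" "x \<le> y"
  shows "((\<lambda>\<xi>. (1 - hypergeometric as bs (- (\<xi>\<^sup>2))) / \<xi>) has_integral
    (hypergeometric_primitive as bs y - hypergeometric_primitive as bs x)) {x..y}"
  by (rule fundamental_theorem_of_calculus[OF assms(2)])
    (simp add: has_real_derivative_iff_has_vector_derivative[symmetric] DERIV_hypergeometric_primitive assms(1))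

lemma hypergeometric_derivatives:
  fixes as bs :: "real list"
  assumes le: "length as \<le> length bs"
  obtains g :: "nat \<Rightarrow> real \<Rightarrow> real"
  where "\<And>s. g 0 s = hypergeometric as bs (- (s\<^sup>2))"
    and "\<And>n s. (g n has_real_derivative g (Suc n) s) (at s)"
    and "\<And>n. g (2 * n) 0 = (- 1) ^ n * fact (2 * n) * (pochhammer_quotient as bs n / fact n)"
proof -
  \<comment> \<open>Padding with zeros at odd indices makes the series a power series in
    \<open>s\<close> itself, so that \<open>diffs\<close> can be iterated to obtain all
    derivatives.\<close>
  define e where "e m = (if even m then (- 1) ^ (m div 2) * (pochhammer_quotient as bs (m div 2) / fact (m div 2)) else 0)" for m
  have e2: "e (2 * n) * s ^ (2 * n) = pochhammer_quotient as bs n / fact n * (- (s\<^sup>2)) ^ n" for n s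
    by (simp add: e_def power_mult power_minus[of "s\<^sup>2"])
  have sm: "strict_mono (\<lambda>n::nat. 2 * n)" by (simp add: strict_mono_def)
  have zero: "e m * s ^ m = 0" if "m \<notin> range (\<lambda>n. 2 * n)" for m s
    using that by (auto simp: e_def elim!: evenE)
  have e_sum: "summable (\<lambda>m. e m * s ^ m)" for s
    using summable_mono_reindex[of "\<lambda>n. 2 * n" "\<lambda>m. e m * s ^ m", OF sm zero] summable_hypergeometric[OF le, of "- (s\<^sup>2)"] by (simp add: e2)
  define g where "g n s = (\<Sum>m. (diffs ^^ n) e m * s ^ m)" for n s
  have d_sum: "summable (\<lambda>m. (diffs ^^ n) e m * s ^ m)" for n s
    by (induction n arbitrary: s) (auto intro: e_sum termdiff_converges_all)
  have diffs_pow: "(diffs ^^ n) e m = fact (m + n) / fact m * e (m + n)" for n m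
  proof (induction n arbitrary: m)
    case (Suc n)
    have "(diffs ^^ Suc n) e m = real (Suc m) * (diffs ^^ n) e (Suc m)"
      by (simp add: diffs_def)
    also have "\<dots> = real (Suc m) * (fact (Suc m + n) / fact (Suc m) * e (Suc m + n))"
      by (simp only: Suc.IH)
    also have "\<dots> = fact (m + Suc n) / fact m * e (m + Suc n)"
      by (simp del: of_nat_Suc)
    finally show ?case .
  qed simp
  show ?thesis
  proof (rule that[of g])
    show "g 0 s = hypergeometric as bs (- (s\<^sup>2))" for s
      using suminf_mono_reindex[of "\<lambda>n. 2 * n" "\<lambda>m. e m * s ^ m", OF sm zero] by (simp add: g_def hypergeometric_altdef e2)
    show "(g n has_real_derivative g (Suc n) s) (at s)" for n s
      using termdiffs_strong_converges_everywhere[OF d_sum, of n s] by (simp add: g_def[abs_def])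
    show "g (2 * n) 0 = (- 1) ^ n * fact (2 * n) * (pochhammer_quotient as bs n / fact n)" for n
      unfolding g_def powser_zero by (simp add: diffs_pow e_def)
  qed
qed

section \<open>Hypergeometric characteristic functions\<close>

lemma (in prob_space) expectation_cos_eq_Re_char:
  assumes [measurable]: "X \<in> borel_measurable M"
  shows "expectation (\<lambda>w. cos (s * X w)) = Re (char (distr M borel X) s)"
proof -
  have "integrable M (\<lambda>w. iexp (s * X w))"
    using integrable_iexp[of "\<lambda>w. complex_of_real (s * X w)"] by simp
  then have "expectation (\<lambda>w. Re (iexp (s * X w))) = Re (CLINT w|M. iexp (s * X w))"
    by (rule integral_Re)
  moreover have "Re (iexp (s * X w)) = cos (s * X w)" for w
    by (simp only: cis_conv_exp[symmetric] cis.sel)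
  ultimately have "expectation (\<lambda>w. cos (s * X w)) = Re (CLINT w|M. iexp (s * X w))"
    by (simp only:)
  also have "(CLINT w|M. iexp (s * X w)) = char (distr M borel X) s"
    unfolding char_def by (subst integral_distr) auto
  finally show ?thesis .
qed

lemma pochhammer_quotient_eq_prod_zip:
  "length as = length bs \<Longrightarrow>
    pochhammer_quotient as bs n = (\<Prod>(a, b)\<leftarrow>zip as bs. pochhammer a n / pochhammer b n)"
proof (induction as bs rule: list_induct2)
  case (Cons a as b bs)
  then show ?case by (simp add: pochhammer_quotient_def flip: Cons.IH)
qed (simp add: pochhammer_quotient_def)

lemma sum_list_diff_zip:
  fixes f g :: "real \<Rightarrow> real"
  shows "length as = length bs \<Longrightarrow>
    (\<Sum>(a, b)\<leftarrow>zip as bs. f a - g b) = (\<Sum>a\<leftarrow>as. f a) - (\<Sum>b\<leftarrow>bs. g b)"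
  by (induction as bs rule: list_induct2) auto

text \<open>
  With \<open>Y = X\<^sup>2 / 4\<close>, the moments are \<open>E[Y\<^sup>n] = (1/2)\<^sub>n (a)\<^sub>n / (b)\<^sub>n\<close>. For \<open>q > p + 1\<close> their ratios
  tend to \<open>0\<close> and \<open>X\<close> would vanish almost surely, so that in fact \<open>q = p + 1\<close> and \<open>Y \<le> 1\<close>.
\<close>
lemma (in prob_space) expectation_ln_abs_of_hypergeometric_char:
  fixes as bs :: "real list"
  assumes [measurable]: "X \<in> borel_measurable M"
    and nz: "AE w in M. X w \<noteq> 0"
    and le: "length as + 1 \<le> length bs"
    and as: "\<forall>a\<in>set as. a > 0" and bs: "\<forall>b\<in>set bs. b > 0"
    and cos: "\<And>s. expectation (\<lambda>w. cos (s * X w)) = hypergeometric as bs (- (s\<^sup>2))"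
  shows "integrable M X" "integrable M (\<lambda>w. ln \<bar>X w\<bar>)"
    and "2 * expectation (\<lambda>w. ln \<bar>X w\<bar>) =
      - euler_mascheroni + (\<Sum>a\<leftarrow>as. Digamma a) - (\<Sum>b\<leftarrow>bs. Digamma b)"
proof -
  have le': "length as \<le> length bs" using le by simp
  \<comment> \<open>The extra upper parameter comes from
    \<open>(2n)! / (4\<^sup>n n!) = (1/2)\<^sub>n\<close>: the factorial is from differentiating
    \<open>2n\<close> times, the power of 4 from the scaling in \<open>Y\<close>.\<close>
  define A where "A = 1 / 2 # as"
  have leA: "length A \<le> length bs" using le by (simp add: A_def)
  obtain g :: "nat \<Rightarrow> real \<Rightarrow> real" where g: "\<And>s. g 0 s = hypergeometric as bs (- (s\<^sup>2))"
    "\<And>n s. (g n has_real_derivative g (Suc n) s) (at s)"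
    "\<And>n. g (2 * n) 0 = (- 1) ^ n * fact (2 * n) * (pochhammer_quotient as bs n / fact n)"
    using hypergeometric_derivatives[OF le'] by blast
  have int: "integrable M (\<lambda>w. X w ^ (2 * n))"
    and mom: "expectation (\<lambda>w. X w ^ (2 * n)) = fact (2 * n) * (pochhammer_quotient as bs n / fact n)" for n
  proof -
    note * = even_moments_from_cos_transform[where X = X and g = g and n = n, OF _ _ g(2)]
    show "integrable M (\<lambda>w. X w ^ (2 * n))"
      by (rule *(1)) (simp_all add: cos g(1))
    have "expectation (\<lambda>w. X w ^ (2 * n)) = (- 1) ^ n * g (2 * n) 0"
      by (rule *(2)) (simp_all add: cos g(1))
    also have "\<dots> = ((- 1) ^ n * (- 1) ^ n) * (fact (2 * n) * (pochhammer_quotient as bs n / fact n))"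
      unfolding g(3) by (simp only: mult.assoc)
    also have "((- 1) ^ n * (- 1) ^ n :: real) = 1" by (simp flip: power_mult_distrib)
    finally show "expectation (\<lambda>w. X w ^ (2 * n)) = fact (2 * n) * (pochhammer_quotient as bs n / fact n)" by simp
  qed
  show "integrable M X"
    by (rule square_integrable_imp_integrable) (use int[of 1] in auto)
  define Y where "Y w = (X w)\<^sup>2 / 4" for w
  have [measurable]: "Y \<in> borel_measurable M" unfolding Y_def by measurable
  have Y_pow: "Y w ^ n = X w ^ (2 * n) / 4 ^ n" for w n
    by (simp add: Y_def power_divide power_mult)
  have Y_int: "integrable M (\<lambda>w. Y w ^ n)" for n
    unfolding Y_pow using int[of n] by simp
  have Y_mom: "expectation (\<lambda>w. Y w ^ n) = pochhammer_quotient A bs n" for n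
  proof -
    have "expectation (\<lambda>w. Y w ^ n) = fact (2 * n) * (pochhammer_quotient as bs n / fact n) / 4 ^ n"
      unfolding Y_pow using mom[of n] by simp
    also have "\<dots> = pochhammer (1 / 2) n * pochhammer_quotient as bs n"
      by (simp add: fact_double power_mult)
    finally show ?thesis by (simp add: A_def pochhammer_quotient_def)
  qed
  have Y_less: "AE w in M. Y w < r" if "(if length A = length bs then 1 else 0) < r" for r
  proof (rule AE_less_of_moment_ratio[OF _ _ Y_int _ pochhammer_quotient_step_LIMSEQ[OF leA] _ that])
    show "Y w \<ge> 0" for w by (simp add: Y_def)
    show "expectation (\<lambda>w. Y w ^ Suc n) =
        (\<Prod>a\<leftarrow>A. a + real n) / (\<Prod>b\<leftarrow>bs. b + real n) * expectation (\<lambda>w. Y w ^ n)" for n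
      by (simp only: Y_mom pochhammer_quotient_Suc)
  qed auto
  have len: "length A = length bs"
  proof (rule ccontr)
    assume "length A \<noteq> length bs"
    then have "AE w in M. Y w < 1 / real (Suc n)" for n using Y_less by simp
    then have "AE w in M. \<forall>n. Y w < 1 / real (Suc n)" by (simp add: AE_all_countable)
    then have "AE w in M. False" using nz
    proof eventually_elim
      case (elim w)
      then have "Y w > 0" by (simp add: Y_def)
      then obtain n where "1 / real (Suc n) < Y w"
        using reals_Archimedean[of "Y w"] by (auto simp: inverse_eq_divide)
      then show ?case using elim(1)[rule_format, of n] by simp
    qed
    then show False by simp
  qed
  have "AE w in M. \<forall>n. Y w < 1 + 1 / real (Suc n)"
    using Y_less len by (simp add: AE_all_countable)
  then have Y01: "AE w in M. 0 < Y w \<and> Y w \<le> 1" using nz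
  proof eventually_elim
    case (elim w)
    have "Y w \<le> 1"
    proof (rule ccontr)
      assume "\<not> Y w \<le> 1"
      then obtain n where "1 / real (Suc n) < Y w - 1"
        using reals_Archimedean[of "Y w - 1"] by (auto simp: inverse_eq_divide)
      then show False using elim(1)[rule_format, of n] by linarith
    qed
    then show ?case using elim by (simp add: Y_def)
  qed
  have pos: "\<forall>(a, b)\<in>set (zip A bs). a > 0 \<and> b > 0"
  proof clarify
    fix a b assume "(a, b) \<in> set (zip A bs)"
    then have "a \<in> set A" "b \<in> set bs" by (rule set_zip_leftD, rule set_zip_rightD)
    then show "a > 0 \<and> b > 0" using as bs by (auto simp: A_def)
  qed
  have lnY: "integrable M (\<lambda>w. ln (Y w))"
    "expectation (\<lambda>w. ln (Y w)) = (\<Sum>a\<leftarrow>A. Digamma a) - (\<Sum>b\<leftarrow>bs. Digamma b)"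
    using expectation_ln_eq_Digamma_sum[OF _ Y01 pos] sum_list_diff_zip[OF len]
    by (simp_all add: Y_mom pochhammer_quotient_eq_prod_zip[OF len])
  have ae: "AE w in M. ln \<bar>X w\<bar> = (ln (Y w) + ln 4) / 2"
    using nz
  proof eventually_elim
    case (elim w)
    have "ln (Y w) = ln (\<bar>X w\<bar>\<^sup>2) - ln 4" using elim by (simp add: Y_def ln_div)
    also have "ln (\<bar>X w\<bar>\<^sup>2) = 2 * ln \<bar>X w\<bar>" using elim by (subst ln_realpow) auto
    finally show ?case by simp
  qed
  have int': "integrable M (\<lambda>w. (ln (Y w) + ln 4) / 2)" using lnY(1) by simp
  show "integrable M (\<lambda>w. ln \<bar>X w\<bar>)"
    by (subst integrable_cong_AE[OF _ _ ae]) (use int' in auto)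
  have "expectation (\<lambda>w. ln \<bar>X w\<bar>) = expectation (\<lambda>w. (ln (Y w) + ln 4) / 2)"
    by (rule integral_cong_AE[OF _ _ ae]) auto
  then have "2 * expectation (\<lambda>w. ln \<bar>X w\<bar>) = expectation (\<lambda>w. ln (Y w)) + ln 4"
    using lnY(1) by (simp add: prob_space)
  \<comment> \<open>This \<open>ln 4\<close> from the scaling cancels the \<open>2 ln 2\<close> in
    the digamma value at \<open>1/2\<close>.\<close>
  moreover have "ln 4 = 2 * ln (2 :: real)" using ln_realpow[of 2 2] by simp
  moreover have "(\<Sum>a\<leftarrow>A. Digamma a) = - euler_mascheroni - 2 * ln 2 + (\<Sum>a\<leftarrow>as. Digamma a)"
    using Digamma_one_half[where 'a = real] by (simp add: A_def)
  ultimately show "2 * expectation (\<lambda>w. ln \<bar>X w\<bar>) =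
      - euler_mascheroni + (\<Sum>a\<leftarrow>as. Digamma a) - (\<Sum>b\<leftarrow>bs. Digamma b)"
    using lnY(2) by simp
qed

theorem mainTheorem2:
  fixes as bs :: "real list" and M :: "'a measure" and X :: "'a \<Rightarrow> real"
    and f :: "real \<Rightarrow> real" and x :: real
  assumes "length as + 1 \<le> length bs"
    and "\<forall>a\<in>set as. a > 0"
    and "\<forall>b\<in>set bs. b > 0"
    and "prob_space M"
    and "distributed M lborel X (\<lambda>t. ennreal (f t))"
    and "\<forall>t. f t \<ge> 0"
    and "\<forall>t. f (- t) = f t"
    and "\<forall>s. char (distr M borel X) s = complex_of_real (hypergeometric as bs (- (s\<^sup>2)))"
    and "x > 0"
  shows "(\<exists>I. has_improper_integral_at_top (\<lambda>\<xi>. hypergeometric as bs (- (\<xi>\<^sup>2)) / \<xi>) I x \<and>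
           2 * I = - euler_mascheroni - 2 * ln x
             - (\<Sum>a\<leftarrow>as. Digamma a) + (\<Sum>b\<leftarrow>bs. Digamma b)
             + 2 * integral {0..x} (\<lambda>\<xi>. (1 - hypergeometric as bs (- (\<xi>\<^sup>2))) / \<xi>)) \<and>
         (\<lambda>\<xi>. (1 - hypergeometric as bs (- (\<xi>\<^sup>2))) / \<xi>) integrable_on {0..x} \<and>
         summable (\<lambda>n. let k = Suc n in
           (\<Prod>a\<leftarrow>as. pochhammer a k) / (\<Prod>b\<leftarrow>bs. pochhammer b k)
             * ((- (x\<^sup>2)) ^ k / (real k * fact k))) \<and>
         2 * integral {0..x} (\<lambda>\<xi>. (1 - hypergeometric as bs (- (\<xi>\<^sup>2))) / \<xi>) =
           - (\<Sum>n. let k = Suc n in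
                (\<Prod>a\<leftarrow>as. pochhammer a k) / (\<Prod>b\<leftarrow>bs. pochhammer b k)
                  * ((- (x\<^sup>2)) ^ k / (real k * fact k)))"
proof -
  interpret prob_space M by fact
  have le: "length as \<le> length bs" using assms(1) by simp
  have X[measurable]: "X \<in> borel_measurable M"
    using assms(5) by (simp add: distributed_def)
  \<comment> \<open>A density leaves no atom at 0, so \<open>ln \<bar>X\<bar>\<close> is meaningful
    almost everywhere.\<close>
  have nz: "AE w in M. X w \<noteq> 0"
  proof -
    have "AE t in distr M lborel X. t \<noteq> 0"
      unfolding distributed_distr_eq_density[OF assms(5)]
      using AE_lborel_singleton[of "0::real"] distributed_borel_measurable[OF assms(5)]
      by (subst AE_density) (auto elim!: eventually_mono)
    then show ?thesis
      by (subst (asm) AE_distr_iff) auto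
  qed
  have cos: "expectation (\<lambda>w. cos (s * X w)) = hypergeometric as bs (- (s\<^sup>2))" for s
    using assms(8) by (simp add: expectation_cos_eq_Re_char)
  note ln_X = expectation_ln_abs_of_hypergeometric_char[OF X nz assms(1-3) cos]
  let ?P = "hypergeometric_primitive as bs"
  have prim: "((\<lambda>\<xi>. (1 - hypergeometric as bs (- (\<xi>\<^sup>2))) / \<xi>) has_integral (?P y - ?P z)) {z..y}"
    if "z \<le> y" for y z
    by (rule has_integral_hypergeometric_primitive[OF le that])
  have P: "integral {0..y} (\<lambda>\<xi>. (1 - hypergeometric as bs (- (\<xi>\<^sup>2))) / \<xi>) = ?P y" if "y \<ge> 0" for y
    using integral_unique[OF prim[OF that]] by simp
  have tail: "((\<lambda>\<xi>. hypergeometric as bs (- (\<xi>\<^sup>2)) / \<xi>) has_integral (ln R - ln x - (?P R - ?P x))) {x..R}"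
    if R: "x \<le> R" for R
  proof -
    have "((\<lambda>\<xi>. 1 / \<xi>) has_integral (ln R - ln x)) {x..R}"
      by (rule fundamental_theorem_of_calculus[OF R])
        (use assms(9) in \<open>auto simp flip: has_real_derivative_iff_has_vector_derivative intro!: derivative_eq_intros\<close>)
    from has_integral_diff[OF this prim[OF R]] show ?thesis
      by (simp flip: diff_divide_distrib)
  qed
  \<comment> \<open>By \<open>tail\<close>, the integral over \<open>{x..R}\<close> is
    \<open>- ln x - (?P R - ln R) + ?P x\<close>; \<open>I\<close> replaces the bracket by its limit
    as \<open>R\<close> grows.\<close>
  define I where "I = - ln x - (euler_mascheroni + expectation (\<lambda>w. ln \<bar>X w\<bar>)) + ?P x"
  have "((\<lambda>R. ?P R - ln R) \<longlongrightarrow> euler_mascheroni + expectation (\<lambda>w. ln \<bar>X w\<bar>)) at_top"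
    using one_minus_cos_transform_asymptotic[OF ln_X(1) nz ln_X(2) Cin_minus_ln_tendsto]
    by (rule Lim_transform_eventually)
      (rule eventually_mono[OF eventually_ge_at_top[of 0]], simp add: cos P)
  then have "((\<lambda>R. - ln x - (?P R - ln R) + ?P x) \<longlongrightarrow> I) at_top"
    unfolding I_def by (intro tendsto_intros)
  then have lim: "((\<lambda>R. integral {x..R} (\<lambda>\<xi>. hypergeometric as bs (- (\<xi>\<^sup>2)) / \<xi>)) \<longlongrightarrow> I) at_top"
    by (rule Lim_transform_eventually)
      (rule eventually_mono[OF eventually_ge_at_top[of x]], simp add: integral_unique[OF tail])
  have "has_improper_integral_at_top (\<lambda>\<xi>. hypergeometric as bs (- (\<xi>\<^sup>2)) / \<xi>) I x"
    unfolding has_improper_integral_at_top_def using tail lim by blast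
  moreover have "2 * I = - euler_mascheroni - 2 * ln x - (\<Sum>a\<leftarrow>as. Digamma a) + (\<Sum>b\<leftarrow>bs. Digamma b) + 2 * ?P x"
    using ln_X(3) by (simp add: I_def algebra_simps)
  moreover have "(\<lambda>\<xi>. (1 - hypergeometric as bs (- (\<xi>\<^sup>2))) / \<xi>) integrable_on {0..x}"
    using prim[of 0 x] assms(9) by (intro has_integral_integrable) auto
  moreover note summable_hypergeometric_primitive[OF le, of x]
  ultimately show ?thesis
    unfolding P[OF less_imp_le[OF assms(9)]] Let_def
    unfolding hypergeometric_primitive_def pochhammer_quotient_def by auto
qed

end
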